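(* Let $\lambda_1<\dots<\lambda_g$ ($g\ge1$) be the characteristic exponents of an irreducible quasi-ordinary polynomial $f\in\mathbb C\{\rho^\vee\cap M\}[Y]$. Let $\Sigma_g$ be the conic polyhedral complex with integral structure associated to the partial embedded resolution $\pi_1\circ\dots\circ\pi_g$ of the hypersurface $f=0$, and let $\Xi$ be the fan in $(N_\Delta)_{\mathbb R}$, both described in the context. Then there is an isomorphism $\Sigma_g\cong\Xi$ of conic polyhedral complexes with integral structure.
   Context: **Data.** $N$ is a lattice of rank $d$, $M$ its dual, $\rho\subset N_{\mathbb R}=N\otimes\mathbb R$ a rational strictly convex cone with $\rho^\vee$ strictly convex; $\mathbb C\{\rho^\vee\cap M\}$ is the ring of convergent power series with exponents in $\rho^\vee\cap M$. A monic $f\in\mathbb C\{\rho^\vee\cap M\}[Y]$ is quasi-ordinary if its discriminant in $Y$ is a monomial times a unit; we assume that $f$ is $Y^{\deg f}$ modulo the maximal ideal. If $f$ is irreducible of degree $n$, its roots lie in $\mathbb C\{\rho^\vee\cap\frac1nM\}$ and differences of distinct roots are of the form $X^{\lambda_{st}}\cdot$unit; the exponents $\lambda_{st}$ (characteristic exponents) are totally ordered by $u\le u'\Leftrightarrow u'\in u+\rho^\vee$. Put $\lambda_0=0$, $M_0=M$, $M_i=M_{i-1}+\lambda_i\mathbb Z$, $n_0=1$, $n_i=[M_i:M_{i-1}]$, $N_i\subset N$ the dual lattice of $M_i$, and $\gamma_1=\lambda_1$, $\gamma_{j+1}=n_j\gamma_j+\lambda_{j+1}-\lambda_j$ for $1\le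 j\le g-1$. **The complex $\Sigma_g$.** For $0\le i\le g-1$ let $M_i'=M_i\oplus y_i\mathbb Z$, $N_i'$ its dual lattice, $\varrho_i=\rho\times\mathbb R_{\ge0}\subset(N_i')_{\mathbb R}$. For $1\le j\le g$ the cone $\varrho_{j-1}$, with lattice $N_{j-1}'$, is subdivided by the hyperplane $y_{j-1}=\lambda_j-\lambda_{j-1}$ into the $(d+1)$-dimensional cones $$\sigma_j^-=\{(a,v)\in\varrho_{j-1}:0\le v\le\langle a,\lambda_j-\lambda_{j-1}\rangle\},\qquad\sigma_j^+=\{(a,v)\in\varrho_{j-1}:v\ge\langle a,\lambda_j-\lambda_{j-1}\rangle\}.$$ $\Sigma_1$ is the subdivision of $(\varrho_0,N_0')$ with maximal cones $\sigma_1^\pm$. For $j\ge2$, $\Sigma_j$ is obtained from $\Sigma_{j-1}$ by adding the subdivision of $(\varrho_{j-1},N_{j-1}')$ with maximal cones $\sigma_j^{\pm}$, glued by identifying the face $\rho\times\{0\}$ of $\sigma_j^-$ (with lattice $N_{j-1}$) with the cone $\sigma_{j-1}^+\cap\sigma_{j-1}^-$ of $\Sigma_{j-1}$ via $a\mapsto(a,\langle a,\lambda_{j-1}-\lambda_{j-2}\rangle)$, which is an isomorphism from $N_{j-1}$ onto the lattice spanned by $(\sigma_{j-1}^+\cap\sigma_{j-1}^-)\cap N_{j-2}'$. ($\Sigma_g$ is the complex, in the sense of Kempf–Knudsen–Mumford–Saint-Donat, of the toroidal embedding on the source $Z_g$ of $\pi_1\circ\dots\circ\pi_g$.) **The fan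 $\Xi$.** Let $N_\Delta=N\oplus\mathbb Z^g$, $u_1,\dots,u_g$ the canonical basis of $\{0\}\oplus\mathbb Z^g$, $\Delta=\rho\oplus\mathbb R_{\ge0}^g$. For $1\le j\le g$ put $$\rho_j^g=\Big\{a+\sum_{i=1}^j\langle a,\gamma_i\rangle u_i+\sum_{i=j+1}^gn_jn_{j+1}\cdots n_{i-1}\langle a,\gamma_j\rangle u_i\ :\ a\in\rho\Big\},\qquad\rho_0^g=\rho\times\{0\}.$$ $\Xi$ is the $(d+1)$-dimensional fan consisting of the faces of the $2g$ cones $\rho_j^g+\mathbb R_{\ge0}u_j$ and $\rho_j^g+\rho_{j-1}^g$, $j=1,\dots,g$. Its integral structure attaches to a cone $\tau\in\Xi$ the lattice $(N_\Delta)_\tau$ spanned by $\tau\cap N_\Delta$. *)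

theory Defs
  imports
    "HOL-Analysis.Analysis"
    "HOL-Analysis.Finite_Function_Topology"
    "HOL-Analysis.Sum_Topology"
    "HOL-Algebra.Divisibility"
    "HOL-Algebra.UnivPoly"
begin

section \<open>Lattices and cones\<close>

text \<open>
  A lattice of rank d is a full lattice in a Euclidean space of dimension d.  That space plays the
  role of the real vector spaces spanned by the lattice and, through the inner product, by its dual.
\<close>

definition add_subgroup :: "'a::ab_group_add set \<Rightarrow> bool" where
  "add_subgroup H \<longleftrightarrow> 0 \<in> H \<and> (\<forall>x\<in>H. \<forall>y\<in>H. x - y \<in> H)"

definition zspan :: "'a::ab_group_add set \<Rightarrow> 'a set" where
  "zspan A = add_subgroup hull A"

definition full_lattice :: "'a::euclidean_space set \<Rightarrow> bool" where
  "full_lattice N \<longleftrightarrow> (\<exists>B. independent B \<and> span B = UNIV \<and> N = zspan B)"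

definition dual_lattice :: "'a::real_inner set \<Rightarrow> 'a set" where
  "dual_lattice N = {u. \<forall>a\<in>N. a \<bullet> u \<in> \<int>}"

definition dual_cone :: "'a::real_inner set \<Rightarrow> 'a set" where
  "dual_cone \<rho> = {u. \<forall>a\<in>\<rho>. 0 \<le> a \<bullet> u}"

definition rational_cone :: "'a::real_vector set \<Rightarrow> 'a set \<Rightarrow> bool" where
  "rational_cone N \<rho> \<longleftrightarrow> (\<exists>A. finite A \<and> A \<subseteq> N \<and> \<rho> = convex_cone hull A)"

definition strictly_convex_cone :: "'a::real_vector set \<Rightarrow> bool" where
  "strictly_convex_cone \<rho> \<longleftrightarrow> \<rho> \<inter> uminus ` \<rho> = {0}"

definition cone_le :: "'a::real_inner set \<Rightarrow> 'a \<Rightarrow> 'a \<Rightarrow> bool" where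
  "cone_le \<rho> u u' \<longleftrightarrow> u' - u \<in> dual_cone \<rho>"


section \<open>Convergent power series with exponents in a cone\<close>

text \<open>
  A series is its coefficient function on exponents.  The points of the affine toric variety of a
  semigroup S are the semigroup homomorphisms from S to the complex numbers.  The special point
  is the homomorphism vanishing outside 0, and the sets given by \<open>cmod (x u) < \<epsilon>\<close> for u
  in a finite subset of \<open>S - {0}\<close> form a basis of its neighbourhoods.
\<close>

definition toric_points :: "'a::comm_monoid_add set \<Rightarrow> ('a \<Rightarrow> complex) set" where
  "toric_points S = {x. x 0 = 1 \<and> (\<forall>u\<in>S. \<forall>v\<in>S. x (u + v) = x u * x v)}"

definition convergent_series :: "'a::comm_monoid_add set \<Rightarrow> ('a \<Rightarrow> complex) \<Rightarrow> bool" where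
  "convergent_series S c \<longleftrightarrow>
     (\<exists>F \<epsilon>. finite F \<and> F \<subseteq> S - {0} \<and> 0 < \<epsilon> \<and>
        (\<forall>x\<in>toric_points S. (\<forall>u\<in>F. cmod (x u) < \<epsilon>) \<longrightarrow>
           (\<lambda>u. cmod (c u * x u)) summable_on S))"

definition monomial :: "'a \<Rightarrow> 'a \<Rightarrow> complex" where
  "monomial u = (\<lambda>v. if v = u then 1 else 0)"

text \<open>
  For S the semigroup of lattice points of a strictly convex cone, the sum in the product
  is finite.
\<close>

definition series_ring :: "'a::ab_group_add set \<Rightarrow> ('a \<Rightarrow> complex) ring" where
  "series_ring S =
    \<lparr>carrier = {c. (\<forall>u. u \<notin> S \<longrightarrow> c u = 0) \<and> convergent_series S c},
     monoid.mult = (\<lambda>c d w. \<Sum>u\<in>{u\<in>S. w - u \<in> S}. c u * d (w - u)),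
     one = monomial 0,
     zero = (\<lambda>_. 0),
     add = (\<lambda>c d u. c u + d u)\<rparr>"

definition lattice_semigroup :: "'a::real_inner set \<Rightarrow> 'a set \<Rightarrow> 'a set" where
  "lattice_semigroup \<rho> M = dual_cone \<rho> \<inter> M"

text \<open>\<open>cseries N \<rho> n\<close> has exponents in \<open>(1/n)M\<close>, where M is dual to N.\<close>

definition frac_semigroup :: "'a::euclidean_space set \<Rightarrow> 'a set \<Rightarrow> nat \<Rightarrow> 'a set" where
  "frac_semigroup N \<rho> n = lattice_semigroup \<rho> ((\<lambda>u. u /\<^sub>R real n) ` dual_lattice N)"

definition cseries :: "'a::euclidean_space set \<Rightarrow> 'a set \<Rightarrow> nat \<Rightarrow> ('a \<Rightarrow> complex) ring" where
  "cseries N \<rho> n = series_ring (frac_semigroup N \<rho> n)"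

definition max_ideal :: "'a::euclidean_space set \<Rightarrow> 'a set \<Rightarrow> ('a \<Rightarrow> complex) set" where
  "max_ideal N \<rho> = {c \<in> carrier (cseries N \<rho> 1). c 0 = 0}"


section \<open>Quasi-ordinary polynomials and characteristic exponents\<close>

definition ring_det :: "('r, 'm) ring_scheme \<Rightarrow> nat \<Rightarrow> (nat \<Rightarrow> nat \<Rightarrow> 'r) \<Rightarrow> 'r" where
  "ring_det R m A =
     (\<Oplus>\<^bsub>R\<^esub>p\<in>{p. p permutes {..<m}}. [sign p] \<cdot>\<^bsub>R\<^esub> (\<Otimes>\<^bsub>R\<^esub>i\<in>{..<m}. A i (p i)))"

definition up_deriv :: "('r, 'm) ring_scheme \<Rightarrow> (nat \<Rightarrow> 'r) \<Rightarrow> nat \<Rightarrow> 'r" where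
  "up_deriv R f = (\<lambda>k. [Suc k] \<cdot>\<^bsub>R\<^esub> f (Suc k))"

text \<open>
  The Sylvester matrix of f (degree n) and its derivative (degree n - 1), of size 2n - 1: the first
  n - 1 rows are shifts of the coefficients of f, the other n rows are shifts of those of f'.
\<close>

definition sylvester_deriv :: "('r, 'm) ring_scheme \<Rightarrow> (nat \<Rightarrow> 'r) \<Rightarrow> nat \<Rightarrow> nat \<Rightarrow> 'r" where
  "sylvester_deriv R f i j =
     (let n = deg R f in
      if i < n - 1
      then (if i \<le> j \<and> j \<le> i + n then f (n + i - j) else \<zero>\<^bsub>R\<^esub>)
      else (if i \<le> j + (n - 1) \<and> j \<le> i then up_deriv R f (i - j) else \<zero>\<^bsub>R\<^esub>))"

definition discriminant :: "('r, 'm) ring_scheme \<Rightarrow> (nat \<Rightarrow> 'r) \<Rightarrow> 'r" where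
  "discriminant R f =
     (let n = deg R f in
      add_pow R ((-1::int) ^ (n * (n - 1) div 2)) (ring_det R (2 * n - 1) (sylvester_deriv R f)))"

definition quasi_ordinary ::
    "'a::euclidean_space set \<Rightarrow> 'a set \<Rightarrow> (nat \<Rightarrow> 'a \<Rightarrow> complex) \<Rightarrow> bool" where
  "quasi_ordinary N \<rho> f \<longleftrightarrow>
     (let R = cseries N \<rho> 1 in
      f \<in> carrier (UP R) \<and>
      coeff (UP R) f (deg R f) = \<one>\<^bsub>R\<^esub> \<and>
      (\<exists>u\<in>frac_semigroup N \<rho> 1. \<exists>e\<in>Units R. discriminant R f = monomial u \<otimes>\<^bsub>R\<^esub> e))"

definition char_exponents ::
    "'a::euclidean_space set \<Rightarrow> 'a set \<Rightarrow> (nat \<Rightarrow> 'a \<Rightarrow> complex) \<Rightarrow> 'a set" where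
  "char_exponents N \<rho> f =
     (let R = cseries N \<rho> 1; n = deg R f; R' = cseries N \<rho> n;
          Roots = {\<zeta> \<in> carrier R'. eval R R' id \<zeta> f = \<zero>\<^bsub>R'\<^esub>}
      in {\<mu> \<in> frac_semigroup N \<rho> n.
            \<exists>\<zeta>\<in>Roots. \<exists>\<xi>\<in>Roots. \<zeta> \<noteq> \<xi> \<and>
              (\<exists>e\<in>Units R'. \<zeta> \<ominus>\<^bsub>R'\<^esub> \<xi> = monomial \<mu> \<otimes>\<^bsub>R'\<^esub> e)})"


section \<open>Lattices and exponents attached to the characteristic exponents\<close>

text \<open>In this section and the next ones it is understood that \<open>lam 0 = 0\<close>.\<close>

primrec M_lat :: "'a::euclidean_space set \<Rightarrow> (nat \<Rightarrow> 'a) \<Rightarrow> nat \<Rightarrow> 'a set" where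
  "M_lat N lam 0 = dual_lattice N"
| "M_lat N lam (Suc i) = {u + of_int k *\<^sub>R lam (Suc i) | u k. u \<in> M_lat N lam i}"

definition group_index :: "'a::ab_group_add set \<Rightarrow> 'a set \<Rightarrow> nat" where
  "group_index A B = card ((\<lambda>u. (\<lambda>v. u + v) ` B) ` A)"

definition n_idx :: "'a::euclidean_space set \<Rightarrow> (nat \<Rightarrow> 'a) \<Rightarrow> nat \<Rightarrow> nat" where
  "n_idx N lam i = (if i = 0 then 1 else group_index (M_lat N lam i) (M_lat N lam (i - 1)))"

text \<open>The value at index 0 is never used.\<close>

fun gam :: "'a::euclidean_space set \<Rightarrow> (nat \<Rightarrow> 'a) \<Rightarrow> nat \<Rightarrow> 'a" where
  "gam N lam 0 = 0"
| "gam N lam (Suc 0) = lam 1"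
| "gam N lam (Suc (Suc j)) =
     real (n_idx N lam (Suc j)) *\<^sub>R gam N lam (Suc j) + lam (Suc (Suc j)) - lam (Suc j)"


section \<open>Conic polyhedral complexes with integral structure\<close>

text \<open>
  The data of a conic polyhedral complex with integral structure: a topological space and the
  charts of its cells.  A chart \<open>(C, L, \<phi>)\<close> parametrizes the cell \<open>\<phi> ` C\<close> by a
  polyhedral cone C with lattice L; a cell may have several charts, differing by linear
  isomorphisms which respect the lattices.  The linear functions on the cell are the ones which are
  linear in a chart, and the integral ones are those which in addition are integral on L.
\<close>

record ('p, 'e) conic_complex =
  cc_space :: "'p topology"
  cc_charts :: "('e set \<times> 'e set \<times> ('e \<Rightarrow> 'p)) set"

definition lattice_cone_iso ::
    "('e::real_vector \<Rightarrow> 'f::real_vector) \<Rightarrow> 'e set \<Rightarrow> 'e set \<Rightarrow> 'f set \<Rightarrow> 'f set \<Rightarrow> bool" where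
  "lattice_cone_iso T C L C' L' \<longleftrightarrow>
     linear T \<and> inj_on T (span C) \<and> T ` C = C' \<and> T ` L = L'"

definition cell_iso ::
    "('p \<Rightarrow> 'q) \<Rightarrow> ('e::real_vector set \<times> 'e set \<times> ('e \<Rightarrow> 'p)) \<Rightarrow>
     ('f::real_vector set \<times> 'f set \<times> ('f \<Rightarrow> 'q)) \<Rightarrow> bool" where
  "cell_iso h c c' \<longleftrightarrow>
     (case (c, c') of ((C, L, \<phi>), (C', L', \<psi>)) \<Rightarrow>
       \<exists>T. lattice_cone_iso T C L C' L' \<and> (\<forall>x\<in>C. h (\<phi> x) = \<psi> (T x)))"

definition conic_complex_iso ::
    "('p \<Rightarrow> 'q) \<Rightarrow> ('p, 'e::real_vector) conic_complex \<Rightarrow>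
     ('q, 'f::real_vector) conic_complex \<Rightarrow> bool" where
  "conic_complex_iso h A B \<longleftrightarrow>
     homeomorphic_map (cc_space A) (cc_space B) h \<and>
     (\<forall>c\<in>cc_charts A. \<exists>c'\<in>cc_charts B. cell_iso h c c') \<and>
     (\<forall>c'\<in>cc_charts B. \<exists>c\<in>cc_charts A. cell_iso h c c')"


section \<open>The complex of the partial embedded resolution\<close>

text \<open>The dual lattice of \<open>M_i \<oplus> y_i \<int>\<close>; the second component is the coordinate \<open>y_i\<close>.\<close>

definition N_prime :: "'a::euclidean_space set \<Rightarrow> (nat \<Rightarrow> 'a) \<Rightarrow> nat \<Rightarrow> ('a \<times> real) set" where
  "N_prime N lam i = dual_lattice (M_lat N lam i \<times> \<int>)"

definition varrho :: "'a set \<Rightarrow> ('a \<times> real) set" where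
  "varrho \<rho> = \<rho> \<times> {0..}"

definition sigma_minus :: "'a::real_inner set \<Rightarrow> (nat \<Rightarrow> 'a) \<Rightarrow> nat \<Rightarrow> ('a \<times> real) set" where
  "sigma_minus \<rho> lam j = {(a, v) \<in> varrho \<rho>. 0 \<le> v \<and> v \<le> a \<bullet> (lam j - lam (j - 1))}"

definition sigma_plus :: "'a::real_inner set \<Rightarrow> (nat \<Rightarrow> 'a) \<Rightarrow> nat \<Rightarrow> ('a \<times> real) set" where
  "sigma_plus \<rho> lam j = {(a, v) \<in> varrho \<rho>. v \<ge> a \<bullet> (lam j - lam (j - 1))}"

text \<open>
  The point \<open>(j, x)\<close> of the disjoint union of the subdivided cones is the point x of the
  j-th one.  All gluings are made at once.
\<close>

definition Sigma_pieces :: "'a::real_inner set \<Rightarrow> nat \<Rightarrow> (nat \<times> 'a \<times> real) topology" where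
  "Sigma_pieces \<rho> g = sum_topology (\<lambda>j. top_of_set (varrho \<rho>)) {1..g}"

definition Sigma_glue ::
    "'a::real_inner set \<Rightarrow> (nat \<Rightarrow> 'a) \<Rightarrow> nat \<Rightarrow> ((nat \<times> 'a \<times> real) \<times> (nat \<times> 'a \<times> real)) set" where
  "Sigma_glue \<rho> lam g =
     {((j, a, 0), (j - 1, a, a \<bullet> (lam (j - 1) - lam (j - 2)))) | j a. 2 \<le> j \<and> j \<le> g \<and> a \<in> \<rho>}"

definition Sigma_equiv ::
    "'a::real_inner set \<Rightarrow> (nat \<Rightarrow> 'a) \<Rightarrow> nat \<Rightarrow> ((nat \<times> 'a \<times> real) \<times> (nat \<times> 'a \<times> real)) set" where
  "Sigma_equiv \<rho> lam g =
     Restr ((Sigma_glue \<rho> lam g \<union> (Sigma_glue \<rho> lam g)\<inverse>)\<^sup>*) (topspace (Sigma_pieces \<rho> g))"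

definition quotient_topology :: "'p topology \<Rightarrow> ('p \<times> 'p) set \<Rightarrow> 'p set topology" where
  "quotient_topology X r = topology (\<lambda>U. U \<subseteq> topspace X // r \<and> openin X (\<Union>U))"

definition Sigma_complex ::
    "'a::euclidean_space set \<Rightarrow> 'a set \<Rightarrow> (nat \<Rightarrow> 'a) \<Rightarrow> nat \<Rightarrow>
     ((nat \<times> 'a \<times> real) set, 'a \<times> real) conic_complex" where
  "Sigma_complex N \<rho> lam g =
    \<lparr>cc_space = quotient_topology (Sigma_pieces \<rho> g) (Sigma_equiv \<rho> lam g),
     cc_charts = {(\<tau>, zspan (\<tau> \<inter> N_prime N lam (j - 1)), \<lambda>x. Sigma_equiv \<rho> lam g `` {(j, x)}) | \<tau> j.
        j \<in> {1..g} \<and> \<tau> \<noteq> {} \<and> (\<tau> face_of sigma_minus \<rho> lam j \<or> \<tau> face_of sigma_plus \<rho> lam j)}\<rparr>"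


section \<open>The fan\<close>

text \<open>
  The real vector space of \<open>N \<oplus> \<int>^g\<close> is realized as the subspace of
  \<open>'a \<times> (nat \<Rightarrow>\<^sub>0 real)\<close> of the vectors whose second component is supported in
  \<open>{1..g}\<close>.
\<close>

definition u_vec :: "nat \<Rightarrow> 'a::real_vector \<times> (nat \<Rightarrow>\<^sub>0 real)" where
  "u_vec i = (0, Poly_Mapping.single i 1)"

definition N_Delta :: "'a set \<Rightarrow> nat \<Rightarrow> ('a \<times> (nat \<Rightarrow>\<^sub>0 real)) set" where
  "N_Delta N g =
     {(a, w). a \<in> N \<and> Poly_Mapping.keys w \<subseteq> {1..g} \<and> (\<forall>i. Poly_Mapping.lookup w i \<in> \<int>)}"

definition rho_cone ::
    "'a::euclidean_space set \<Rightarrow> 'a set \<Rightarrow> (nat \<Rightarrow> 'a) \<Rightarrow> nat \<Rightarrow> nat \<Rightarrow>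
     ('a \<times> (nat \<Rightarrow>\<^sub>0 real)) set" where
  "rho_cone N \<rho> lam g j =
     (if j = 0 then \<rho> \<times> {0}
      else (\<lambda>a. (a, 0)
              + (\<Sum>i=1..j. (a \<bullet> gam N lam i) *\<^sub>R u_vec i)
              + (\<Sum>i=j+1..g. (real (\<Prod>k=j..i-1. n_idx N lam k) * (a \<bullet> gam N lam j)) *\<^sub>R u_vec i)) ` \<rho>)"

definition mink_sum :: "'e::plus set \<Rightarrow> 'e set \<Rightarrow> 'e set" where
  "mink_sum A B = {x + y | x y. x \<in> A \<and> y \<in> B}"

definition Xi_max_cones ::
    "'a::euclidean_space set \<Rightarrow> 'a set \<Rightarrow> (nat \<Rightarrow> 'a) \<Rightarrow> nat \<Rightarrow> ('a \<times> (nat \<Rightarrow>\<^sub>0 real)) set set" where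
  "Xi_max_cones N \<rho> lam g =
     (\<lambda>j. mink_sum (rho_cone N \<rho> lam g j) ((\<lambda>t. t *\<^sub>R u_vec j) ` {0..})) ` {1..g} \<union>
     (\<lambda>j. mink_sum (rho_cone N \<rho> lam g j) (rho_cone N \<rho> lam g (j - 1))) ` {1..g}"

definition Xi_fan ::
    "'a::euclidean_space set \<Rightarrow> 'a set \<Rightarrow> (nat \<Rightarrow> 'a) \<Rightarrow> nat \<Rightarrow> ('a \<times> (nat \<Rightarrow>\<^sub>0 real)) set set" where
  "Xi_fan N \<rho> lam g = {\<tau>. \<tau> \<noteq> {} \<and> (\<exists>\<sigma>\<in>Xi_max_cones N \<rho> lam g. \<tau> face_of \<sigma>)}"

definition Xi_complex ::
    "'a::euclidean_space set \<Rightarrow> 'a set \<Rightarrow> (nat \<Rightarrow> 'a) \<Rightarrow> nat \<Rightarrow>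
     ('a \<times> (nat \<Rightarrow>\<^sub>0 real), 'a \<times> (nat \<Rightarrow>\<^sub>0 real)) conic_complex" where
  "Xi_complex N \<rho> lam g =
    \<lparr>cc_space = top_of_set (\<Union>(Xi_fan N \<rho> lam g)),
     cc_charts = (\<lambda>\<tau>. (\<tau>, zspan (\<tau> \<inter> N_Delta N g), id)) ` Xi_fan N \<rho> lam g\<rparr>"

end

theory Submission
  imports Defs
begin

text \<open>
  Write \<open>\<mu>\<^sub>j = \<lambda>\<^sub>j - \<lambda>\<^sub>j\<^sub>-\<^sub>1\<close>, let \<open>r\<^sub>j(a)\<close> be the point of the cone \<open>\<rho>\<^sub>j\<close> of the
  fan over \<open>a \<in> \<rho>\<close>, and put \<open>e\<^sub>j = u\<^sub>j + n\<^sub>j u\<^sub>j\<^sub>+\<^sub>1 + n\<^sub>j n\<^sub>j\<^sub>+\<^sub>1 u\<^sub>j\<^sub>+\<^sub>2 + \<dots>\<close>.  The recursion for the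
  \<open>\<gamma>\<^sub>j\<close> says \<open>r\<^sub>j(a) = r\<^sub>j\<^sub>-\<^sub>1(a) + \<langle>a, \<mu>\<^sub>j\<rangle> e\<^sub>j\<close>.  Hence the linear maps
  \<open>(a, v) \<mapsto> r\<^sub>j\<^sub>-\<^sub>1(a) + v e\<^sub>j\<close> on \<open>\<sigma>\<^sub>j\<^sup>-\<close> and \<open>(a, v) \<mapsto> r\<^sub>j(a) + (v - \<langle>a, \<mu>\<^sub>j\<rangle>) u\<^sub>j\<close> on \<open>\<sigma>\<^sub>j\<^sup>+\<close>
  agree on the wall, are compatible with the gluing, and have the maximal cones of the fan as images.
  On both cones the j-th coordinate is \<open>n\<^sub>j\<^sub>-\<^sub>1\<langle>a, \<gamma>\<^sub>j\<^sub>-\<^sub>1\<rangle> + v\<close>, so \<open>(a, v)\<close> can be recovered continuously;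
  this makes the glued map closed and shows that it identifies no more than the gluing does.  The
  lattices correspond because a is in \<open>N\<^sub>j\<^sub>-\<^sub>1\<close> iff it is in N and pairs integrally with
  \<open>\<gamma>\<^sub>1, \<dots>, \<gamma>\<^sub>j\<^sub>-\<^sub>1\<close>, and \<open>n\<^sub>j \<lambda>\<^sub>j\<close> is in \<open>M\<^sub>j\<^sub>-\<^sub>1\<close>.
\<close>

section \<open>Lattices\<close>

lemma add_subgroup_zspan: "add_subgroup (zspan A)"
  unfolding zspan_def hull_def add_subgroup_def by blast

lemma subset_zspan: "A \<subseteq> zspan A"
  by (simp add: zspan_def hull_subset)

lemma zspan_minimal: "A \<subseteq> H \<Longrightarrow> add_subgroup H \<Longrightarrow> zspan A \<subseteq> H"
  by (simp add: zspan_def hull_minimal)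

lemma add_subgroupD:
  assumes "add_subgroup H"
  shows "0 \<in> H" "x \<in> H \<Longrightarrow> y \<in> H \<Longrightarrow> x - y \<in> H" "x \<in> H \<Longrightarrow> - x \<in> H"
    "x \<in> H \<Longrightarrow> y \<in> H \<Longrightarrow> x + y \<in> H"
proof -
  show z: "0 \<in> H" and d: "x \<in> H \<Longrightarrow> y \<in> H \<Longrightarrow> x - y \<in> H" for x y
    using assms by (auto simp: add_subgroup_def)
  show n: "x \<in> H \<Longrightarrow> - x \<in> H" for x
    using d[OF z, of x] by simp
  show "x \<in> H \<Longrightarrow> y \<in> H \<Longrightarrow> x + y \<in> H"
    using d[of x "- y"] n[of y] by simp
qed

lemma add_subgroup_sum:
  assumes "add_subgroup H" "\<And>i. i \<in> I \<Longrightarrow> x i \<in> H"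
  shows "sum x I \<in> H"
  using assms(2)
  by (induction I rule: infinite_finite_induct) (auto intro: add_subgroupD[OF assms(1)])

lemma add_subgroup_scaleR_int:
  fixes x :: "'a::real_vector"
  assumes H: "add_subgroup H" and x: "x \<in> H" and c: "c \<in> \<int>"
  shows "c *\<^sub>R x \<in> H"
proof -
  have nat: "real k *\<^sub>R x \<in> H" for k
    by (induction k) (auto simp: scaleR_left_distrib intro: add_subgroupD[OF H] x)
  obtain k where k: "c = of_int k" using c by (auto elim: Ints_cases)
  show ?thesis
  proof (cases "0 \<le> k")
    case True
    then show ?thesis using nat[of "nat k"] k by simp
  next
    case False
    then show ?thesis using add_subgroupD(3)[OF H nat[of "nat (- k)"]] k by simp
  qed
qed

lemma zspan_linear_image:
  assumes "linear T"
  shows "T ` zspan A = zspan (T ` A)"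
proof
  have "add_subgroup (T -` zspan (T ` A))"
    using add_subgroup_zspan[of "T ` A"] linear_0[OF assms] linear_diff[OF assms]
    by (auto simp: add_subgroup_def)
  then have "zspan A \<subseteq> T -` zspan (T ` A)"
    by (intro zspan_minimal) (use subset_zspan in force)+
  then show "T ` zspan A \<subseteq> zspan (T ` A)" by auto
  have "add_subgroup (T ` zspan A)"
    unfolding add_subgroup_def
  proof (intro conjI ballI)
    show "0 \<in> T ` zspan A"
      using linear_0[OF assms] add_subgroupD(1)[OF add_subgroup_zspan, of A] by (metis imageI)
    fix x y assume "x \<in> T ` zspan A" "y \<in> T ` zspan A"
    then show "x - y \<in> T ` zspan A"
      using add_subgroupD(2)[OF add_subgroup_zspan, of _ A]
      by (auto simp flip: linear_diff[OF assms])
  qed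
  then show "zspan (T ` A) \<subseteq> T ` zspan A"
    by (intro zspan_minimal image_mono subset_zspan)
qed

text \<open>The coordinate functionals of a lattice basis are integral on \<open>N\<close>, so the
  vectors representing them lie in the dual. Pairing with these makes the coordinates of a point of
  the double dual integers.\<close>

lemma dual_dual_lattice:
  fixes N :: "'a::euclidean_space set"
  assumes "full_lattice N"
  shows "dual_lattice (dual_lattice N) = N"
proof
  show "N \<subseteq> dual_lattice (dual_lattice N)"
    by (auto simp: dual_lattice_def inner_commute)
next
  obtain B where B: "independent B" "span B = UNIV" and N: "N = zspan B"
    using assms by (auto simp: full_lattice_def)
  have fB: "finite B" using B(1) by (simp add: independent_imp_finite)
  show "dual_lattice (dual_lattice N) \<subseteq> N"
  proof
    fix a assume a: "a \<in> dual_lattice (dual_lattice N)"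
    have coord: "representation B a b \<in> \<int>" if b: "b \<in> B" for b
    proof -
      define c where "c = (\<lambda>x. representation B x b)"
      have lin: "linear c"
        unfolding c_def using B
        by (intro linearI) (simp_all add: representation_add representation_scale)
      have c: "c x = x \<bullet> adjoint c 1" for x
        using adjoint_works[OF lin, of x 1] by (simp add: inner_commute)
      have "add_subgroup {x. c x \<in> \<int>}"
        using linear_0[OF lin] linear_diff[OF lin] by (auto simp: add_subgroup_def)
      moreover have "B \<subseteq> {x. c x \<in> \<int>}"
        using B(1) by (auto simp: c_def representation_basis)
      ultimately have "N \<subseteq> {x. c x \<in> \<int>}"
        unfolding N by (rule zspan_minimal[rotated])
      then have "adjoint c 1 \<in> dual_lattice N"
        using c by (auto simp: dual_lattice_def)
      then have "adjoint c 1 \<bullet> a \<in> \<int>"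
        using a unfolding dual_lattice_def[of "dual_lattice N"] by blast
      then show ?thesis
        using c[of a] by (simp add: c_def inner_commute)
    qed
    have "a = (\<Sum>b\<in>B. representation B a b *\<^sub>R b)"
      using B fB by (simp add: sum_representation_eq)
    also have "\<dots> \<in> N"
      unfolding N
      by (intro add_subgroup_sum add_subgroup_scaleR_int add_subgroup_zspan coord)
        (use subset_zspan in blast)
    finally show "a \<in> N" .
  qed
qed

section \<open>The lattices of the exponents and their duals\<close>

lemma add_subgroup_dual_lattice: "add_subgroup (dual_lattice N)"
  by (auto simp: add_subgroup_def dual_lattice_def inner_diff_right)

lemma add_subgroup_M_lat: "add_subgroup (M_lat N lam i)"
proof (induction i)
  case 0
  then show ?case by (simp add: add_subgroup_dual_lattice)
next
  case (Suc i)
  show ?case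
    unfolding add_subgroup_def
  proof (intro conjI ballI)
    show "0 \<in> M_lat N lam (Suc i)"
      using add_subgroupD(1)[OF Suc] by (auto intro!: exI[of _ 0])
    fix x y assume "x \<in> M_lat N lam (Suc i)" "y \<in> M_lat N lam (Suc i)"
    then obtain u k v l where "x = u + of_int k *\<^sub>R lam (Suc i)" "y = v + of_int l *\<^sub>R lam (Suc i)"
      "u \<in> M_lat N lam i" "v \<in> M_lat N lam i" by auto
    then have "x - y = (u - v) + of_int (k - l) *\<^sub>R lam (Suc i)" "u - v \<in> M_lat N lam i"
      by (auto simp: algebra_simps intro: add_subgroupD[OF Suc])
    then show "x - y \<in> M_lat N lam (Suc i)" unfolding M_lat.simps by blast
  qed
qed

text \<open>
  Translation by x permutes the cosets, so summing representatives over all cosets shows that the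
  index multiplies x into B.  An infinite index is 0 by convention, and the claim still holds.
\<close>

lemma group_index_scaleR_mem:
  fixes A B :: "'a::real_vector set"
  assumes A: "add_subgroup A" and B: "add_subgroup B" and x: "x \<in> A"
  shows "real (group_index A B) *\<^sub>R x \<in> B"
proof -
  define coset where "coset = (\<lambda>u. (+) u ` B)"
  define Q where "Q = coset ` A"
  define rep where "rep = inv_into A coset"
  define tr where "tr = (`) ((+) x)"
  have rep: "rep q \<in> A" "coset (rep q) = q" if "q \<in> Q" for q
    using that by (auto simp: rep_def Q_def inv_into_into f_inv_into_f)
  have tr_coset: "tr (coset u) = coset (x + u)" for u
    by (auto simp: tr_def coset_def image_image algebra_simps)
  have coset_eq: "u - v \<in> B" if "coset u = coset v" for u v
  proof -
    have "u \<in> coset u" using add_subgroupD(1)[OF B] by (force simp: coset_def)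
    then show ?thesis using that by (auto simp: coset_def)
  qed
  have "bij_betw tr Q Q"
    unfolding bij_betw_def
  proof
    have "inj tr" unfolding tr_def by (auto intro!: inj_onI dest: inj_image_eq_iff[THEN iffD1, rotated])
    then show "inj_on tr Q" by (rule inj_on_subset) simp
    have "q \<in> tr ` Q" if q: "q \<in> Q" for q
    proof -
      obtain u where u: "u \<in> A" "q = coset u" using q by (auto simp: Q_def)
      then have "q = tr (coset (u - x))" by (simp add: tr_coset)
      then show ?thesis using u x add_subgroupD(2)[OF A] by (auto simp: Q_def)
    qed
    then show "tr ` Q = Q"
      using x by (auto simp: Q_def tr_coset intro: add_subgroupD[OF A])
  qed
  then have "(\<Sum>q\<in>Q. rep (tr q)) = (\<Sum>q\<in>Q. rep q)"
    by (rule sum.reindex_bij_betw)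
  then have "real (card Q) *\<^sub>R x = - (\<Sum>q\<in>Q. rep (tr q) - (x + rep q))"
    by (simp add: sum_subtractf sum.distrib sum_constant_scaleR)
  also have "\<dots> \<in> B"
  proof (intro add_subgroupD(3)[OF B] add_subgroup_sum[OF B] coset_eq)
    fix q assume q: "q \<in> Q"
    have "tr q \<in> Q" using \<open>bij_betw tr Q Q\<close> q by (auto simp: bij_betw_def)
    then show "coset (rep (tr q)) = coset (x + rep q)"
      using rep[OF q] rep(2)[of "tr q"] tr_coset[of "rep q"] by simp
  qed
  finally show ?thesis
    by (simp add: group_index_def Q_def coset_def)
qed

text \<open>The index of a subgroup multiplies the group into it. The integrality of
  \<open>up j\<close> beyond the \<open>j\<close>-th coordinate rests on this.\<close>

lemma n_idx_scaleR_lam_mem: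
  assumes "1 \<le> j"
  shows "real (n_idx N lam j) *\<^sub>R lam j \<in> M_lat N lam (j - 1)"
proof -
  obtain i where j: "j = Suc i" using assms by (cases j) auto
  have "lam j \<in> M_lat N lam j"
    unfolding j using add_subgroupD(1)[OF add_subgroup_M_lat, of N lam i] 
    by (auto intro!: exI[of _ 0] exI[of _ "1::int"])
  then show ?thesis
    using group_index_scaleR_mem[OF add_subgroup_M_lat add_subgroup_M_lat] assms
    by (simp add: n_idx_def)
qed

text \<open>Integrality can be tested on generators, here the dual of \<open>N\<close> and the first
  \<open>i\<close> exponents. The base case is biduality.\<close>

lemma mem_dual_M_lat_iff:
  assumes "full_lattice N"
  shows "a \<in> dual_lattice (M_lat N lam i) \<longleftrightarrow> a \<in> N \<and> (\<forall>k\<in>{1..i}. a \<bullet> lam k \<in> \<int>)"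
proof (induction i)
  case 0
  then show ?case by (simp add: dual_dual_lattice[OF assms])
next
  case (Suc i)
  have "a \<in> dual_lattice (M_lat N lam (Suc i)) \<longleftrightarrow>
      a \<in> dual_lattice (M_lat N lam i) \<and> a \<bullet> lam (Suc i) \<in> \<int>" (is "?L \<longleftrightarrow> ?R")
  proof
    assume L: ?L
    have "u \<in> M_lat N lam (Suc i)" if "u \<in> M_lat N lam i" for u
      using that by (auto intro!: exI[of _ u] exI[of _ "0::int"])
    moreover have "lam (Suc i) \<in> M_lat N lam (Suc i)"
      using add_subgroupD(1)[OF add_subgroup_M_lat, of N lam i] 
      by (auto intro!: exI[of _ 0] exI[of _ "1::int"])
    ultimately show ?R
      using L unfolding dual_lattice_def by (auto simp: inner_commute simp del: M_lat.simps)
  next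
    assume ?R
    then show ?L
      by (auto simp: dual_lattice_def inner_add_left inner_commute[of a])
  qed
  also have "\<dots> \<longleftrightarrow> a \<in> N \<and> (\<forall>k\<in>{1..Suc i}. a \<bullet> lam k \<in> \<int>)"
    unfolding Suc by (auto simp: atLeastAtMostSuc_conv)
  finally show ?case .
qed

lemma mem_N_prime_iff:
  "(a, v) \<in> N_prime N lam i \<longleftrightarrow> a \<in> dual_lattice (M_lat N lam i) \<and> v \<in> \<int>"
proof
  assume L: "(a, v) \<in> N_prime N lam i"
  have "u \<bullet> a + k * v \<in> \<int>" if "u \<in> M_lat N lam i" "k \<in> \<int>" for u k
    using L that by (auto simp: N_prime_def dual_lattice_def)
  from this[of _ 0] this[of 0 1] add_subgroupD(1)[OF add_subgroup_M_lat, of N lam i]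
  show "a \<in> dual_lattice (M_lat N lam i) \<and> v \<in> \<int>"
    by (auto simp: dual_lattice_def)
qed (auto simp: N_prime_def dual_lattice_def)


section \<open>Quotient spaces, finitely supported functions and faces\<close>

text \<open>Distinct classes are disjoint, so unions commute with intersecting two sets of classes.
  Hence the defining predicate is a topology and \<open>topology\<close> returns it
  unchanged.\<close>

lemma openin_quotient_topology:
  assumes "equiv (topspace X) r"
  shows "openin (quotient_topology X r) U \<longleftrightarrow> U \<subseteq> topspace X // r \<and> openin X (\<Union>U)"
proof -
  have "istopology (\<lambda>U. U \<subseteq> topspace X // r \<and> openin X (\<Union>U))"
    unfolding istopology_def
  proof (intro conjI allI impI)
    fix S T
    assume S: "S \<subseteq> topspace X // r \<and> openin X (\<Union>S)" and T: "T \<subseteq> topspace X // r \<and> openin X (\<Union>T)"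
    have "\<Union>(S \<inter> T) = \<Union>S \<inter> \<Union>T"
      using S T quotient_disj[OF assms] by blast
    then show "openin X (\<Union>(S \<inter> T))" using S T by auto
  next
    fix K assume K: "\<forall>S\<in>K. S \<subseteq> topspace X // r \<and> openin X (\<Union>S)"
    have "\<Union>(\<Union>K) = (\<Union>S\<in>K. \<Union>S)" by auto
    then show "openin X (\<Union>(\<Union>K))" using K by auto
  qed auto
  then show ?thesis by (simp add: quotient_topology_def)
qed

text \<open>A quotient map factors through the quotient by its own kernel, and the factor is an
  injective quotient map, that is, a homeomorphism.\<close>

lemma homeomorphic_map_quotient_kernel:
  assumes F: "quotient_map X Y F"
    and r: "r = {(x, y). x \<in> topspace X \<and> y \<in> topspace X \<and> F x = F y}"
    and h: "\<And>x. x \<in> topspace X \<Longrightarrow> h (r `` {x}) = F x"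
  shows "homeomorphic_map (quotient_topology X r) Y h"
proof -
  have eq: "equiv (topspace X) r"
    unfolding r by (auto simp: equiv_def refl_on_def sym_def trans_def)
  note op = openin_quotient_topology[OF eq]
  have top: "topspace (quotient_topology X r) = topspace X // r"
  proof
    show "topspace (quotient_topology X r) \<subseteq> topspace X // r"
      using op openin_topspace by blast
    have "openin (quotient_topology X r) (topspace X // r)"
      using Union_quotient[OF eq] by (simp add: op)
    then show "topspace X // r \<subseteq> topspace (quotient_topology X r)"
      by (rule openin_subset)
  qed
  have "topspace X // r = (\<lambda>x. r `` {x}) ` topspace X"
    by (auto simp: quotient_def)
  then have "h ` (topspace X // r) = topspace Y"
    using F h by (simp add: image_image quotient_map_def)
  moreover have "openin (quotient_topology X r) {c \<in> topspace X // r. h c \<in> U} \<longleftrightarrow> openin Y U"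
    if U: "U \<subseteq> topspace Y" for U
  proof -
    have "\<Union>{c \<in> topspace X // r. h c \<in> U} = {x \<in> topspace X. F x \<in> U}" (is "?A = ?B")
    proof
      show "?A \<subseteq> ?B" using h by (auto simp: quotient_def r)
      show "?B \<subseteq> ?A"
      proof
        fix x assume x: "x \<in> ?B"
        then have "x \<in> r `` {x}" "r `` {x} \<in> topspace X // r" "h (r `` {x}) \<in> U"
          using h[of x] by (auto simp: quotient_def r)
        then show "x \<in> ?A" by blast
      qed
    qed
    moreover have "openin X {x \<in> topspace X. F x \<in> U} \<longleftrightarrow> openin Y U"
      using F U by (simp add: quotient_map_def)
    ultimately show ?thesis by (auto simp: op)
  qed
  moreover have "inj_on h (topspace X // r)"
  proof (rule inj_onI)
    fix c d assume "c \<in> topspace X // r" "d \<in> topspace X // r" "h c = h d"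
    then obtain x y where "x \<in> topspace X" "y \<in> topspace X" "c = r `` {x}" "d = r `` {y}" "F x = F y"
      by (auto elim!: quotientE simp: h)
    then show "c = d" by (auto simp: r)
  qed
  ultimately show ?thesis
    by (simp add: homeomorphic_map_def quotient_map_def top)
qed

lemma lookup_scaleR [simp]:
  "Poly_Mapping.lookup (c *\<^sub>R w) i = c *\<^sub>R Poly_Mapping.lookup w i"
proof -
  have "finite {i. c *\<^sub>R Poly_Mapping.lookup w i \<noteq> 0}"
    by (rule finite_subset[OF _ finite_lookup[of w]]) auto
  then show ?thesis by (simp add: scaleR_poly_mapping_def Abs_poly_mapping_inverse)
qed

text \<open>The norm is the sum of the norms of the entries and dominates each of them. This makes
  coordinates continuous.\<close>

lemma bounded_linear_lookup:
  "bounded_linear (\<lambda>w::'i \<Rightarrow>\<^sub>0 'b::real_normed_vector. Poly_Mapping.lookup w i)"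
proof (rule bounded_linear_intro[where K = 1])
  fix w :: "'i \<Rightarrow>\<^sub>0 'b"
  have "norm w = (\<Sum>k\<in>Poly_Mapping.keys w. norm (Poly_Mapping.lookup w k))"
    by (simp add: norm_poly_mapping_def dist_poly_mapping_def)
  moreover have "norm (Poly_Mapping.lookup w i) \<le> \<dots>"
  proof (cases "i \<in> Poly_Mapping.keys w")
    case True
    then show ?thesis by (intro member_le_sum) auto
  next
    case False
    then show ?thesis by (simp add: in_keys_iff sum_nonneg)
  qed
  ultimately show "norm (Poly_Mapping.lookup w i) \<le> norm w * 1" by simp
qed (simp_all add: lookup_add)

lemma mem_N_Delta_iff:
  "x \<in> N_Delta N g \<longleftrightarrow> fst x \<in> N \<and> (\<forall>i. Poly_Mapping.lookup (snd x) i \<in> \<int>) \<and>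
     (\<forall>i. i \<notin> {1..g} \<longrightarrow> Poly_Mapping.lookup (snd x) i = 0)"
  by (cases x) (auto simp: N_Delta_def in_keys_iff subset_iff)

lemma faces_of_linear_image:
  assumes "linear T" "inj T"
  shows "{F. F face_of T ` S} = (`) T ` {F. F face_of S}"
proof -
  have "\<exists>F'. F' face_of S \<and> F = T ` F'" if F: "F face_of T ` S" for F
  proof -
    obtain F' where "F = T ` F'" using face_of_imp_subset[OF F] by (auto simp: subset_image_iff)
    then show ?thesis using F face_of_linear_image[OF assms] by blast
  qed
  then show ?thesis using face_of_linear_image[OF assms] by (auto simp: image_iff)
qed


section \<open>The piecewise linear map\<close>

text \<open>The polyhedral data extracted from the polynomial: the increments of the exponents pair
  nonnegatively with \<rho>. Starting at \<open>lam 0 = 0\<close> makes the first exponent an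
  increment too.\<close>

locale exponent_chain =
  fixes N \<rho> :: "'a::euclidean_space set"
    and lam :: "nat \<Rightarrow> 'a"
    and g :: nat
  assumes lattice: "full_lattice N"
    and cone: "convex_cone \<rho>"
    and lam_0: "lam 0 = 0"
    and step: "\<And>j. j \<in> {1..g} \<Longrightarrow> lam j - lam (j - 1) \<in> dual_cone \<rho>"
begin

abbreviation "\<nu> \<equiv> n_idx N lam"
abbreviation "\<gamma> \<equiv> gam N lam"

definition "\<mu> j = lam j - lam (j - 1)"

text \<open>\<open>tail j\<close> and \<open>apex j a\<close> are the vectors \<open>e\<^sub>j\<close> and \<open>r\<^sub>j(a)\<close> of the introduction.\<close>

definition tail :: "nat \<Rightarrow> 'a \<times> (nat \<Rightarrow>\<^sub>0 real)" where
  "tail j = (\<Sum>i=j..g. real (\<Prod>k=j..i-1. \<nu> k) *\<^sub>R u_vec i)"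

definition apex :: "nat \<Rightarrow> 'a \<Rightarrow> 'a \<times> (nat \<Rightarrow>\<^sub>0 real)" where
  "apex j a = (a, 0) + (\<Sum>i=1..j. (a \<bullet> \<gamma> i) *\<^sub>R u_vec i) + (real (\<nu> j) * (a \<bullet> \<gamma> j)) *\<^sub>R tail (Suc j)"

text \<open>Both \<open>low j\<close> and \<open>up j\<close> are linear on the whole space; only
  \<open>piece_map j\<close> separates the two sides of the wall, where they agree.\<close>

definition low :: "nat \<Rightarrow> 'a \<times> real \<Rightarrow> 'a \<times> (nat \<Rightarrow>\<^sub>0 real)" where
  "low j x = apex (j - 1) (fst x) + snd x *\<^sub>R tail j"

definition up :: "nat \<Rightarrow> 'a \<times> real \<Rightarrow> 'a \<times> (nat \<Rightarrow>\<^sub>0 real)" where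
  "up j x = apex j (fst x) + (snd x - fst x \<bullet> \<mu> j) *\<^sub>R u_vec j"

definition piece_map :: "nat \<Rightarrow> 'a \<times> real \<Rightarrow> 'a \<times> (nat \<Rightarrow>\<^sub>0 real)" where
  "piece_map j x = (if snd x \<le> fst x \<bullet> \<mu> j then low j x else up j x)"

text \<open>The conventions \<open>gam N lam 0 = 0\<close> and \<open>lam 0 = 0\<close> let the
  recursion start at \<open>j = 1\<close>, so the first piece obeys the same formulas as the
  others.\<close>

lemma gamma_step:
  assumes "1 \<le> j"
  shows "\<gamma> j = real (\<nu> (j - 1)) *\<^sub>R \<gamma> (j - 1) + \<mu> j"
proof -
  obtain i where j: "j = Suc i" using assms by (cases j) auto
  show ?thesis unfolding j using lam_0 by (cases i) (simp_all add: \<mu>_def)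
qed

lemma tail_step:
  assumes "j \<in> {1..g}"
  shows "tail j = u_vec j + real (\<nu> j) *\<^sub>R tail (Suc j)"
proof -
  have "(\<Sum>i=Suc j..g. real (\<Prod>k=j..i-1. \<nu> k) *\<^sub>R u_vec i) =
      real (\<nu> j) *\<^sub>R (tail (Suc j) :: 'a \<times> _)"
    unfolding tail_def scaleR_sum_right
  proof (rule sum.cong[OF refl])
    fix i assume "i \<in> {Suc j..g}"
    then have "(\<Prod>k=j..i-1. \<nu> k) = \<nu> j * (\<Prod>k=Suc j..i-1. \<nu> k)"
      by (intro prod.atLeast_Suc_atMost) auto
    then show "real (\<Prod>k=j..i-1. \<nu> k) *\<^sub>R u_vec i =
        real (\<nu> j) *\<^sub>R (real (\<Prod>k=Suc j..i-1. \<nu> k) *\<^sub>R (u_vec i :: 'a \<times> _))"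
      by simp
  qed
  \<comment> \<open>The empty product gives \<open>u_vec j\<close> the coefficient 1. This needs
    \<open>1 \<le> j\<close>, because \<open>j - 1\<close> is truncated at 0.\<close>
  moreover have "{j..j-1} = {}" using assms by auto
  ultimately show ?thesis
    using assms by (simp add: tail_def[of j] sum.atLeast_Suc_atMost)
qed

text \<open>\<open>tail_step\<close> absorbs the \<open>j\<close>-th term of \<open>apex j a\<close>
  into a multiple of \<open>tail j\<close>; \<open>gamma_step\<close> splits this into the tail of
  \<open>apex (j - 1) a\<close> and the increment.\<close>

lemma apex_step:
  assumes "j \<in> {1..g}"
  shows "apex j a = apex (j - 1) a + (a \<bullet> \<mu> j) *\<^sub>R tail j"
proof -
  have j: "Suc (j - 1) = j" using assms by simp
  have "{1..j} = insert j {1..j - 1}" "j \<notin> {1..j-1}" using assms by auto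
  then have "apex j a = (a, 0) + (\<Sum>i=1..j-1. (a \<bullet> \<gamma> i) *\<^sub>R u_vec i) + (a \<bullet> \<gamma> j) *\<^sub>R tail j"
    unfolding apex_def tail_step[OF assms] by (simp add: algebra_simps)
  also have "a \<bullet> \<gamma> j = real (\<nu> (j - 1)) * (a \<bullet> \<gamma> (j - 1)) + a \<bullet> \<mu> j"
    using assms by (subst gamma_step) (simp_all add: inner_add_right)
  finally show ?thesis
    unfolding apex_def[of "j - 1"] j by (simp add: scaleR_left_distrib add.assoc)
qed

lemma apex_0: "apex 0 a = (a, 0)"
  by (simp add: apex_def)

lemma linear_apex: "linear (apex j)"
proof (rule linearI)
  have pair: "(a + b, 0::nat \<Rightarrow>\<^sub>0 real) = (a, 0) + (b, 0)" "(c *\<^sub>R a, 0::nat \<Rightarrow>\<^sub>0 real) = c *\<^sub>R (a, 0)"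
    for a b :: 'a and c by simp_all
  show "apex j (a + b) = apex j a + apex j b" for a b
    unfolding apex_def pair
    by (simp only: inner_add_left distrib_left scaleR_left_distrib sum.distrib) (simp only: ac_simps)
  show "apex j (c *\<^sub>R a) = c *\<^sub>R apex j a" for c a
    unfolding apex_def pair
    by (simp add: scaleR_sum_right scaleR_right_distrib mult.left_commute)
qed

lemma linear_low: "linear (low j)"
  by (rule linearI)
    (simp_all add: low_def linear_add[OF linear_apex] linear_scale[OF linear_apex] algebra_simps)

lemma linear_up: "linear (up j)"
  by (rule linearI)
    (simp_all add: up_def linear_add[OF linear_apex] linear_scale[OF linear_apex] algebra_simps
       inner_add_left)

lemma fst_u_vec: "fst (u_vec i) = 0"
  by (simp add: u_vec_def)

lemma fst_tail: "fst (tail j) = 0"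
  by (simp add: tail_def fst_sum fst_u_vec)

lemma fst_apex: "fst (apex j a) = a"
  by (simp add: apex_def fst_sum fst_u_vec fst_tail)

section \<open>Coordinates and a common left inverse of \<open>low j\<close> and
  \<open>up j\<close>\<close>

definition coord :: "nat \<Rightarrow> 'a \<times> (nat \<Rightarrow>\<^sub>0 real) \<Rightarrow> real" where
  "coord i x = Poly_Mapping.lookup (snd x) i"

lemma coord_simps [simp]:
  "coord i (x + y) = coord i x + coord i y" "coord i (c *\<^sub>R x) = c * coord i x"
  by (simp_all add: coord_def lookup_add)

lemma bounded_linear_coord: "bounded_linear (coord i)"
  unfolding coord_def
  by (rule bounded_linear_compose[OF bounded_linear_lookup bounded_linear_snd])

lemma coord_sum: "coord i (sum x I) = (\<Sum>k\<in>I. coord i (x k))"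
  using linear_sum[OF bounded_linear.linear[OF bounded_linear_coord]] .

lemma coord_u_vec: "coord i (u_vec k) = (if i = k then 1 else 0)"
  by (simp add: coord_def u_vec_def lookup_single when_def)

lemma coord_tail: "coord i (tail j) = (if i \<in> {j..g} then real (\<Prod>k=j..i-1. \<nu> k) else 0)"
  by (simp add: tail_def coord_sum coord_u_vec if_distrib cong: if_cong)

lemma coord_apex:
  "coord i (apex j a) =
     (if i \<in> {1..j} then a \<bullet> \<gamma> i else real (\<nu> j) * (a \<bullet> \<gamma> j) * coord i (tail (Suc j)))"
proof -
  have "coord i (a, 0) = 0" by (simp add: coord_def)
  moreover have "coord i (tail (Suc j)) = 0" if "i \<in> {1..j}"
    using that by (simp add: coord_tail)
  ultimately show ?thesis
    by (auto simp: apex_def coord_sum coord_u_vec if_distrib cong: if_cong)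
qed

lemma fst_low: "fst (low j x) = fst x" and fst_up: "fst (up j x) = fst x"
  by (simp_all add: low_def up_def fst_apex fst_tail fst_u_vec)

text \<open>Before the \<open>j\<close>-th coordinate only the apex contributes. This later detects
  overlaps of different pieces.\<close>

lemma coord_low_less: "i \<in> {1..<j} \<Longrightarrow> coord i (low j x) = fst x \<bullet> \<gamma> i"
  and coord_up_less: "i \<in> {1..<j} \<Longrightarrow> coord i (up j x) = fst x \<bullet> \<gamma> i"
  by (auto simp: low_def up_def coord_apex coord_tail coord_u_vec)

lemma coord_tail_self: "j \<in> {1..g} \<Longrightarrow> coord j (tail j) = 1"
  by (auto simp: coord_tail)

lemma coord_low_self:
  assumes "j \<in> {1..g}"
  shows "coord j (low j x) = real (\<nu> (j - 1)) * (fst x \<bullet> \<gamma> (j - 1)) + snd x"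
  using assms by (auto simp: low_def coord_apex coord_tail_self)

text \<open>\<open>up\<close> measures \<open>snd x\<close> from the wall, but the recursion for
  \<gamma> adds the height of the wall back.\<close>

lemma coord_up_self:
  assumes "j \<in> {1..g}"
  shows "coord j (up j x) = real (\<nu> (j - 1)) * (fst x \<bullet> \<gamma> (j - 1)) + snd x"
proof -
  have "coord j (up j x) = fst x \<bullet> \<gamma> j + (snd x - fst x \<bullet> \<mu> j)"
    using assms by (auto simp: up_def coord_apex coord_u_vec)
  also have "fst x \<bullet> \<gamma> j = real (\<nu> (j - 1)) * (fst x \<bullet> \<gamma> (j - 1)) + fst x \<bullet> \<mu> j"
    using assms by (subst gamma_step) (simp_all add: inner_add_right)
  finally show ?thesis by simp
qed

text \<open>Solves the common formula for the \<open>j\<close>-th coordinate for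
  \<open>snd x\<close>; one continuous map thus inverts both branches.\<close>

definition retract :: "nat \<Rightarrow> 'a \<times> (nat \<Rightarrow>\<^sub>0 real) \<Rightarrow> 'a \<times> real" where
  "retract j y = (fst y, coord j y - real (\<nu> (j - 1)) * (fst y \<bullet> \<gamma> (j - 1)))"

lemma retract_low: "j \<in> {1..g} \<Longrightarrow> retract j (low j x) = x"
  and retract_up: "j \<in> {1..g} \<Longrightarrow> retract j (up j x) = x"
  and retract_piece_map: "j \<in> {1..g} \<Longrightarrow> retract j (piece_map j x) = x"
  by (auto simp: retract_def fst_low fst_up coord_low_self coord_up_self piece_map_def)

lemma inj_low: "j \<in> {1..g} \<Longrightarrow> inj (low j)" and inj_up: "j \<in> {1..g} \<Longrightarrow> inj (up j)"
  by (metis injI retract_low) (metis injI retract_up)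

lemma low_eq_up:
  assumes "j \<in> {1..g}" "snd x = fst x \<bullet> \<mu> j"
  shows "low j x = up j x"
  using assms apex_step[OF assms(1), of "fst x"] by (simp add: low_def up_def)

lemma piece_map_minus:
  assumes "x \<in> sigma_minus \<rho> lam j"
  shows "piece_map j x = low j x"
  using assms by (auto simp: sigma_minus_def piece_map_def \<mu>_def)

lemma piece_map_plus:
  assumes "j \<in> {1..g}" "x \<in> sigma_plus \<rho> lam j"
  shows "piece_map j x = up j x"
proof (cases "snd x = fst x \<bullet> \<mu> j")
  case True
  then show ?thesis using low_eq_up[OF assms(1)] by (simp add: piece_map_def)
next
  case False
  then show ?thesis using assms by (auto simp: sigma_plus_def piece_map_def \<mu>_def)
qed


section \<open>Integral structures\<close>

text \<open>Multiplied by \<open>\<nu> j\<close>, the recursion leaves integral terms and the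
  pairing with \<open>\<nu> j *\<^sub>R lam j\<close>, which lies in
  \<open>M_lat N lam (j - 1)\<close>. The pairing with \<open>\<gamma> j\<close> alone need not be
  integral.\<close>

lemma nu_gamma_integral:
  assumes j: "j \<in> {1..g}" and a: "a \<in> N" "\<And>k. k \<in> {1..<j} \<Longrightarrow> a \<bullet> lam k \<in> \<int>"
    and g: "a \<bullet> \<gamma> (j - 1) \<in> \<int>"
  shows "real (\<nu> j) * (a \<bullet> \<gamma> j) \<in> \<int>"
proof -
  have "a \<bullet> lam (j - 1) \<in> \<int>"
    using a(2)[of "j - 1"] lam_0 j by (cases "j = 1") auto
  moreover have "a \<in> dual_lattice (M_lat N lam (j - 1))"
    using a by (auto simp: mem_dual_M_lat_iff[OF lattice])
  then have "a \<bullet> (real (\<nu> j) *\<^sub>R lam j) \<in> \<int>"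
    using n_idx_scaleR_lam_mem[of j N lam] j by (auto simp: dual_lattice_def inner_commute)
  moreover have "real (\<nu> j) * (a \<bullet> \<gamma> j) =
      real (\<nu> j) * (real (\<nu> (j - 1)) * (a \<bullet> \<gamma> (j - 1)) - a \<bullet> lam (j - 1)) + a \<bullet> (real (\<nu> j) *\<^sub>R lam j)"
    using j by (subst gamma_step) (simp_all add: inner_add_right inner_diff_right \<mu>_def algebra_simps)
  ultimately show ?thesis using g by simp
qed

text \<open>The recursion is triangular: \<open>\<gamma> (Suc j)\<close> and
  \<open>lam (Suc j)\<close> differ by an integral combination of \<open>\<gamma> j\<close> and
  \<open>lam j\<close>.\<close>

lemma lam_integral_iff_gamma:
  "(\<forall>k\<in>{1..j}. a \<bullet> lam k \<in> \<int>) \<longleftrightarrow> (\<forall>k\<in>{1..j}. a \<bullet> \<gamma> k \<in> \<int>)"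
proof (induction j)
  case (Suc j)
  have "a \<bullet> \<gamma> (Suc j) \<in> \<int> \<longleftrightarrow> a \<bullet> lam (Suc j) \<in> \<int>"
    if *: "\<forall>k\<in>{1..j}. a \<bullet> lam k \<in> \<int>" "\<forall>k\<in>{1..j}. a \<bullet> \<gamma> k \<in> \<int>"
  proof -
    have "a \<bullet> lam j \<in> \<int>" "a \<bullet> \<gamma> j \<in> \<int>"
      using * lam_0 by (cases j; auto)+
    moreover have "a \<bullet> \<gamma> (Suc j) = real (\<nu> j) * (a \<bullet> \<gamma> j) - a \<bullet> lam j + a \<bullet> lam (Suc j)"
      by (subst gamma_step) (simp_all add: inner_add_right inner_diff_right \<mu>_def)
    moreover have "a \<bullet> lam (Suc j) = a \<bullet> \<gamma> (Suc j) - (real (\<nu> j) * (a \<bullet> \<gamma> j) - a \<bullet> lam j)"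
      using calculation(3) by simp
    ultimately show ?thesis by (metis Ints_add Ints_diff Ints_mult Ints_of_nat)
  qed
  then show ?case using Suc by (auto simp: atLeastAtMostSuc_conv)
qed simp

lemma mem_N_prime_iff_gamma:
  assumes "1 \<le> j"
  shows "x \<in> N_prime N lam (j - 1) \<longleftrightarrow>
    fst x \<in> N \<and> (\<forall>k\<in>{1..<j}. fst x \<bullet> \<gamma> k \<in> \<int>) \<and> snd x \<in> \<int>"
proof -
  have "{1..j - 1} = {1..<j}" using assms by auto
  then show ?thesis
    using lam_integral_iff_gamma[of "j - 1" "fst x"]
    by (cases x) (simp add: mem_N_prime_iff mem_dual_M_lat_iff[OF lattice])
qed

lemma mem_N_Delta_iff_coord:
  "y \<in> N_Delta N g \<longleftrightarrow>
     fst y \<in> N \<and> (\<forall>i\<in>{1..g}. coord i y \<in> \<int>) \<and> (\<forall>i. i \<notin> {1..g} \<longrightarrow> coord i y = 0)"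
  unfolding mem_N_Delta_iff coord_def by (metis Ints_0)

text \<open>The part common to \<open>low\<close> and \<open>up\<close>. For the way back, the
  coordinates before the \<open>j\<close>-th give the pairings with the \<open>\<gamma> k\<close>,
  and the \<open>j\<close>-th one then gives \<open>snd x\<close>; so later coordinates matter in
  one direction only.\<close>

lemma piece_integral_iff:
  assumes j: "j \<in> {1..g}"
    and fst: "fst y = fst x" and less: "\<And>i. i \<in> {1..<j} \<Longrightarrow> coord i y = fst x \<bullet> \<gamma> i"
    and self: "coord j y = real (\<nu> (j - 1)) * (fst x \<bullet> \<gamma> (j - 1)) + snd x"
    and greater: "\<And>i. i \<in> {j<..g} \<Longrightarrow> x \<in> N_prime N lam (j - 1) \<Longrightarrow> coord i y \<in> \<int>"
    and outside: "\<And>i. i \<notin> {1..g} \<Longrightarrow> coord i y = 0"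
  shows "x \<in> N_prime N lam (j - 1) \<longleftrightarrow> y \<in> N_Delta N g"
proof -
  note iff = mem_N_prime_iff_gamma[of j x] mem_N_Delta_iff_coord[of y]
  have prev: "fst x \<bullet> \<gamma> (j - 1) \<in> \<int>" if "\<forall>k\<in>{1..<j}. fst x \<bullet> \<gamma> k \<in> \<int>"
    using that j by (cases "j = 1") auto
  show ?thesis
  proof
    assume x: "x \<in> N_prime N lam (j - 1)"
    then have x': "fst x \<in> N" "\<forall>k\<in>{1..<j}. fst x \<bullet> \<gamma> k \<in> \<int>" "snd x \<in> \<int>"
      using iff(1) j by auto
    have "coord i y \<in> \<int>" if i: "i \<in> {1..g}" for i
    proof -
      consider "i < j" | "i = j" | "j < i" by linarith
      then show ?thesis
        using x' less[of i] self greater[OF _ x, of i] prev[OF x'(2)] i by cases auto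
    qed
    then show "y \<in> N_Delta N g" using iff(2) x'(1) fst outside by auto
  next
    assume "y \<in> N_Delta N g"
    then have y: "fst x \<in> N" "\<forall>i\<in>{1..g}. coord i y \<in> \<int>" using iff(2) fst by auto
    then have *: "\<forall>k\<in>{1..<j}. fst x \<bullet> \<gamma> k \<in> \<int>" using less j by force
    have "snd x = coord j y - real (\<nu> (j - 1)) * (fst x \<bullet> \<gamma> (j - 1))" using self by simp
    then have "snd x \<in> \<int>" using y(2) j prev[OF *] by auto
    then show "x \<in> N_prime N lam (j - 1)" using iff(1) j y(1) * by auto
  qed
qed

lemma prev_gamma_integral:
  assumes "j \<in> {1..g}" "x \<in> N_prime N lam (j - 1)"
  shows "fst x \<bullet> \<gamma> (j - 1) \<in> \<int>"
  using assms mem_N_prime_iff_gamma[of j x] by (cases "j = 1") auto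

text \<open>Beyond \<open>j\<close> every coordinate is the \<open>j\<close>-th one times a product
  of indices.\<close>

lemma low_integral_iff:
  assumes j: "j \<in> {1..g}"
  shows "x \<in> N_prime N lam (j - 1) \<longleftrightarrow> low j x \<in> N_Delta N g"
proof (rule piece_integral_iff[OF j fst_low coord_low_less coord_low_self[OF j]])
  fix i assume i: "i \<in> {j<..g}" and x: "x \<in> N_prime N lam (j - 1)"
  then have "coord i (low j x) =
      (real (\<nu> (j - 1)) * (fst x \<bullet> \<gamma> (j - 1)) + snd x) * real (\<Prod>k=j..i-1. \<nu> k)"
    using j by (auto simp: low_def coord_apex coord_tail algebra_simps)
  then show "coord i (low j x) \<in> \<int>"
    using prev_gamma_integral[OF j x] mem_N_prime_iff_gamma[of j x] x j by (auto simp del: of_nat_prod)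
next
  fix i assume "i \<notin> {1..g}"
  then show "coord i (low j x) = 0" using j by (auto simp: low_def coord_apex coord_tail)
qed

text \<open>Beyond \<open>j\<close> only the tail of \<open>apex j\<close> contributes, with a
  coefficient that \<open>nu_gamma_integral\<close> makes integral.\<close>

lemma up_integral_iff:
  assumes j: "j \<in> {1..g}"
  shows "x \<in> N_prime N lam (j - 1) \<longleftrightarrow> up j x \<in> N_Delta N g"
proof (rule piece_integral_iff[OF j fst_up coord_up_less coord_up_self[OF j]])
  fix i assume i: "i \<in> {j<..g}" and x: "x \<in> N_prime N lam (j - 1)"
  then have "coord i (up j x) = real (\<nu> j) * (fst x \<bullet> \<gamma> j) * real (\<Prod>k=Suc j..i-1. \<nu> k)"
    using j by (auto simp: up_def coord_apex coord_tail coord_u_vec)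
  moreover have "real (\<nu> j) * (fst x \<bullet> \<gamma> j) \<in> \<int>"
  proof (rule nu_gamma_integral[OF j])
    have "(fst x, snd x) \<in> N_prime N lam (j - 1)" using x by simp
    then show "fst x \<in> N" "\<And>k. k \<in> {1..<j} \<Longrightarrow> fst x \<bullet> lam k \<in> \<int>"
      unfolding mem_N_prime_iff mem_dual_M_lat_iff[OF lattice] by auto
  qed (rule prev_gamma_integral[OF j x])
  ultimately show "coord i (up j x) \<in> \<int>" by (auto simp del: of_nat_prod)
next
  fix i assume "i \<notin> {1..g}"
  then show "coord i (up j x) = 0" using j by (auto simp: up_def coord_apex coord_tail coord_u_vec)
qed


section \<open>Images of the cones\<close>

lemma cone_simps:
  "0 \<in> \<rho>" "a \<in> \<rho> \<Longrightarrow> b \<in> \<rho> \<Longrightarrow> a + b \<in> \<rho>" "a \<in> \<rho> \<Longrightarrow> 0 \<le> c \<Longrightarrow> c *\<^sub>R a \<in> \<rho>"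
  using cone by (simp_all add: convex_cone_contains_0 convex_cone_add convex_cone_scaleR)

lemma step_nonneg: "j \<in> {1..g} \<Longrightarrow> a \<in> \<rho> \<Longrightarrow> 0 \<le> a \<bullet> \<mu> j"
  using step[of j] by (auto simp: dual_cone_def \<mu>_def)

text \<open>Factoring \<open>\<nu> j\<close> out of the products leaves the coefficients of
  \<open>tail (Suc j)\<close>. For \<open>j = 0\<close> the tail of the apex vanishes since
  \<open>gam N lam 0 = 0\<close>.\<close>

lemma rho_cone_eq: "rho_cone N \<rho> lam g j = apex j ` \<rho>"
proof (cases "j = 0")
  case True
  then show ?thesis by (auto simp: rho_cone_def apex_0)
next
  case False
  have "(\<Sum>i=j+1..g. (real (\<Prod>k=j..i-1. \<nu> k) * (a \<bullet> \<gamma> j)) *\<^sub>R (u_vec i :: 'a \<times> _)) =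
      (real (\<nu> j) * (a \<bullet> \<gamma> j)) *\<^sub>R tail (Suc j)" for a
    unfolding tail_def scaleR_sum_right Suc_eq_plus1[symmetric]
  proof (rule sum.cong[OF refl])
    fix i assume "i \<in> {Suc j..g}"
    then have "(\<Prod>k=j..i-1. \<nu> k) = \<nu> j * (\<Prod>k=Suc j..i-1. \<nu> k)"
      by (intro prod.atLeast_Suc_atMost) auto
    then show "(real (\<Prod>k=j..i-1. \<nu> k) * (a \<bullet> \<gamma> j)) *\<^sub>R u_vec i =
        (real (\<nu> j) * (a \<bullet> \<gamma> j)) *\<^sub>R (real (\<Prod>k=Suc j..i-1. \<nu> k) *\<^sub>R (u_vec i :: 'a \<times> _))"
      by (simp add: ac_simps)
  qed
  then show ?thesis using False by (simp add: rho_cone_def apex_def)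
qed

lemma mem_sigma_minus_iff:
    "x \<in> sigma_minus \<rho> lam j \<longleftrightarrow> fst x \<in> \<rho> \<and> 0 \<le> snd x \<and> snd x \<le> fst x \<bullet> \<mu> j"
  and mem_sigma_plus_iff:
    "x \<in> sigma_plus \<rho> lam j \<longleftrightarrow> fst x \<in> \<rho> \<and> 0 \<le> snd x \<and> fst x \<bullet> \<mu> j \<le> snd x"
  by (cases x; auto simp: sigma_minus_def sigma_plus_def varrho_def \<mu>_def)+

lemma up_image_sigma_plus:
  assumes j: "j \<in> {1..g}"
  shows "up j ` sigma_plus \<rho> lam j =
    mink_sum (rho_cone N \<rho> lam g j) ((\<lambda>t. t *\<^sub>R u_vec j) ` {0..})"
proof
  show "up j ` sigma_plus \<rho> lam j \<subseteq> mink_sum (rho_cone N \<rho> lam g j) ((\<lambda>t. t *\<^sub>R u_vec j) ` {0..})"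
  proof (rule image_subsetI)
    fix x assume "x \<in> sigma_plus \<rho> lam j"
    then have "fst x \<in> \<rho>" "0 \<le> snd x - fst x \<bullet> \<mu> j"
      by (auto simp: mem_sigma_plus_iff)
    then show "up j x \<in> mink_sum (rho_cone N \<rho> lam g j) ((\<lambda>t. t *\<^sub>R u_vec j) ` {0..})"
      unfolding rho_cone_eq up_def mink_sum_def by blast
  qed
  show "mink_sum (rho_cone N \<rho> lam g j) ((\<lambda>t. t *\<^sub>R u_vec j) ` {0..}) \<subseteq> up j ` sigma_plus \<rho> lam j"
  proof
    fix y assume "y \<in> mink_sum (rho_cone N \<rho> lam g j) ((\<lambda>t. t *\<^sub>R u_vec j) ` {0..})"
    then obtain a t where a: "a \<in> \<rho>" "t \<in> {0..}" "y = apex j a + t *\<^sub>R u_vec j"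
      unfolding rho_cone_eq mink_sum_def by blast
    then have "y = up j (a, t + a \<bullet> \<mu> j)" by (simp add: up_def)
    moreover have "(a, t + a \<bullet> \<mu> j) \<in> sigma_plus \<rho> lam j"
      using a step_nonneg[OF j a(1)] by (simp add: mem_sigma_plus_iff)
    ultimately show "y \<in> up j ` sigma_plus \<rho> lam j" by blast
  qed
qed

lemma low_image_sigma_minus:
  assumes j: "j \<in> {1..g}"
  shows "low j ` sigma_minus \<rho> lam j = mink_sum (rho_cone N \<rho> lam g j) (rho_cone N \<rho> lam g (j - 1))"
proof -
  \<comment> \<open>Expressing \<open>apex j b\<close> through \<open>tail j\<close> turns the
    Minkowski sum into points at height \<open>b \<bullet> \<mu> j\<close> over
    \<open>b + c\<close>.\<close>
  have split: "apex j b + apex (j - 1) c = low j (b + c, b \<bullet> \<mu> j)" for b c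
    using apex_step[OF j] by (simp add: low_def linear_add[OF linear_apex])
  show ?thesis
  proof
    show "low j ` sigma_minus \<rho> lam j \<subseteq> mink_sum (rho_cone N \<rho> lam g j) (rho_cone N \<rho> lam g (j - 1))"
    proof (rule image_subsetI)
      fix x assume x: "x \<in> sigma_minus \<rho> lam j"
      obtain a v where av: "x = (a, v)" by (cases x)
      have a: "a \<in> \<rho>" "0 \<le> v" "v \<le> a \<bullet> \<mu> j"
        using x av by (auto simp: mem_sigma_minus_iff)
      \<comment> \<open>The fraction of the wall height reached by \<open>v\<close> divides
        \<open>a\<close> between the two cones. If that height is 0, then \<open>v = 0\<close> and
        division by zero gives \<open>s = 0\<close>, which still fits.\<close>
      define s where "s = v / (a \<bullet> \<mu> j)"
      have s: "0 \<le> s" "s \<le> 1" "s * (a \<bullet> \<mu> j) = v"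
        using a by (auto simp: s_def divide_simps)
      have "low j (a, v) = apex j (s *\<^sub>R a) + apex (j - 1) ((1 - s) *\<^sub>R a)"
        unfolding split using s by (simp add: algebra_simps)
      moreover have "s *\<^sub>R a \<in> \<rho>" "(1 - s) *\<^sub>R a \<in> \<rho>" using a s by (simp_all add: cone_simps)
      ultimately show "low j x \<in> mink_sum (rho_cone N \<rho> lam g j) (rho_cone N \<rho> lam g (j - 1))"
        unfolding av rho_cone_eq mink_sum_def by blast
    qed
    show "mink_sum (rho_cone N \<rho> lam g j) (rho_cone N \<rho> lam g (j - 1)) \<subseteq> low j ` sigma_minus \<rho> lam j"
    proof
      fix y assume "y \<in> mink_sum (rho_cone N \<rho> lam g j) (rho_cone N \<rho> lam g (j - 1))"
      then obtain b c where bc: "b \<in> \<rho>" "c \<in> \<rho>" "y = low j (b + c, b \<bullet> \<mu> j)"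
        unfolding rho_cone_eq mink_sum_def split[symmetric] by blast
      then have "(b + c, b \<bullet> \<mu> j) \<in> sigma_minus \<rho> lam j"
        using step_nonneg[OF j bc(1)] step_nonneg[OF j bc(2)]
        by (simp add: mem_sigma_minus_iff cone_simps inner_add_left)
      then show "y \<in> low j ` sigma_minus \<rho> lam j" using bc(3) by blast
    qed
  qed
qed

section \<open>The cones and the support of the fan\<close>

lemma Xi_max_cones_eq:
  "Xi_max_cones N \<rho> lam g = (\<Union>j\<in>{1..g}. {low j ` sigma_minus \<rho> lam j, up j ` sigma_plus \<rho> lam j})"
  unfolding Xi_max_cones_def by (auto simp: low_image_sigma_minus up_image_sigma_plus)

lemma Xi_fan_eq:
  "Xi_fan N \<rho> lam g =
     (\<Union>j\<in>{1..g}. (`) (low j) ` {\<tau>. \<tau> \<noteq> {} \<and> \<tau> face_of sigma_minus \<rho> lam j} \<union>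
                (`) (up j) ` {\<tau>. \<tau> \<noteq> {} \<and> \<tau> face_of sigma_plus \<rho> lam j})"
proof -
  have 1: "{\<tau>. \<tau> \<noteq> {} \<and> \<tau> face_of T ` \<sigma>} = (`) T ` {\<tau>. \<tau> \<noteq> {} \<and> \<tau> face_of \<sigma>}"
    if T: "linear T" "inj T" for T :: "'a \<times> real \<Rightarrow> 'a \<times> (nat \<Rightarrow>\<^sub>0 real)" and \<sigma>
    using faces_of_linear_image[OF T, of \<sigma>] by blast
  have "Xi_fan N \<rho> lam g =
     (\<Union>j\<in>{1..g}. {\<tau>. \<tau> \<noteq> {} \<and> \<tau> face_of low j ` sigma_minus \<rho> lam j} \<union>
                {\<tau>. \<tau> \<noteq> {} \<and> \<tau> face_of up j ` sigma_plus \<rho> lam j})"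
    unfolding Xi_fan_def Xi_max_cones_eq by blast
  then show ?thesis
    by (simp add: 1 linear_low inj_low linear_up inj_up)
qed

lemma convex_sigma: "convex (sigma_minus \<rho> lam j)" "convex (sigma_plus \<rho> lam j)"
  unfolding convex_def Ball_def mem_sigma_minus_iff mem_sigma_plus_iff
  by (auto simp: cone_simps inner_add_left intro!: add_mono mult_left_mono)

lemma sigma_cover:
  "varrho \<rho> = sigma_minus \<rho> lam j \<union> sigma_plus \<rho> lam j"
  by (auto simp: sigma_minus_def sigma_plus_def varrho_def)

lemma Union_Xi_fan: "\<Union>(Xi_fan N \<rho> lam g) = (\<Union>j\<in>{1..g}. piece_map j ` varrho \<rho>)"
proof -
  have faces: "\<Union>((`) T ` {\<tau>. \<tau> \<noteq> {} \<and> \<tau> face_of \<sigma>}) = T ` \<sigma>" if "convex \<sigma>"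
    for T :: "'a \<times> real \<Rightarrow> 'a \<times> (nat \<Rightarrow>\<^sub>0 real)" and \<sigma>
    using face_of_refl[OF that] face_of_imp_subset[of _ \<sigma>] by blast
  have "piece_map j ` varrho \<rho> = low j ` sigma_minus \<rho> lam j \<union> up j ` sigma_plus \<rho> lam j"
    if "j \<in> {1..g}" for j
    unfolding sigma_cover[of j] image_Un
    using piece_map_minus[of _ j] piece_map_plus[OF that] by simp
  moreover have Union: "\<Union>(\<Union>j\<in>I. A j \<union> B j) = (\<Union>j\<in>I. \<Union>(A j) \<union> \<Union>(B j))"
    for I :: "nat set" and A B :: "nat \<Rightarrow> ('a \<times> (nat \<Rightarrow>\<^sub>0 real)) set set"
    by blast
  ultimately show ?thesis
    unfolding Xi_fan_eq Union by (simp add: faces convex_sigma)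
qed


section \<open>The homeomorphism\<close>

definition glue_map :: "nat \<times> 'a \<times> real \<Rightarrow> 'a \<times> (nat \<Rightarrow>\<^sub>0 real)" where
  "glue_map p = piece_map (fst p) (snd p)"

lemma topspace_Sigma_pieces: "topspace (Sigma_pieces \<rho> g) = {1..g} \<times> varrho \<rho>"
  by (simp add: Sigma_pieces_def o_def)

lemma continuous_on_piece_map:
  assumes "j \<in> {1..g}"
  shows "continuous_on UNIV (piece_map j)"
proof -
  \<comment> \<open>One formula for both branches: cut the height off at the wall, then add the
    excess along \<open>u_vec j\<close>.\<close>
  have eq: "piece_map j = (\<lambda>x. low j (fst x, min (snd x) (fst x \<bullet> \<mu> j)) +
      max 0 (snd x - fst x \<bullet> \<mu> j) *\<^sub>R u_vec j)"
    using apex_step[OF assms] by (auto simp: fun_eq_iff piece_map_def up_def low_def min_def max_def)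
  have "continuous_on UNIV (low j)"
    by (rule linear_continuous_on_compose[OF continuous_on_id linear_low])
  then have "continuous_on UNIV (\<lambda>x. low j (fst x, min (snd x) (fst x \<bullet> \<mu> j)))"
    by (rule continuous_on_compose2) (auto intro!: continuous_intros)
  then show ?thesis
    unfolding eq by (rule continuous_on_add) (intro continuous_intros)
qed

text \<open>Closed conditions cut the image out of the support: \<open>retract j y\<close> lies in
  \<open>D\<close> at nonnegative height, and \<open>piece_map j\<close> takes it back to
  \<open>y\<close>. Membership of \<open>fst y\<close> in \<rho> holds on the whole support.\<close>

lemma closedin_piece_map_image:
  assumes j: "j \<in> {1..g}" and C: "closedin (top_of_set (varrho \<rho>)) C"
  shows "closedin (top_of_set (\<Union>(Xi_fan N \<rho> lam g))) (piece_map j ` C)"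
proof -
  obtain D where D: "closed D" "C = varrho \<rho> \<inter> D" using C by (auto simp: closedin_closed)
  have retract: "continuous_on UNIV (retract j)"
    unfolding retract_def
    by (intro continuous_intros linear_continuous_on bounded_linear_coord)
  define E where "E = retract j -` (D \<inter> UNIV \<times> {0..}) \<inter> {y. piece_map j (retract j y) = y}"
  have "closed (UNIV \<times> {0..} :: ('a \<times> real) set)" by (intro closed_Times) auto
  then have "closed E"
    unfolding E_def
    by (intro closed_Int closed_vimage retract D(1) closed_Collect_eq continuous_on_id
        continuous_on_compose2[OF continuous_on_piece_map[OF j] retract]) auto
  moreover have "piece_map j ` C = \<Union>(Xi_fan N \<rho> lam g) \<inter> E"
  proof
    show "piece_map j ` C \<subseteq> \<Union>(Xi_fan N \<rho> lam g) \<inter> E"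
      using j D(2) by (auto simp: E_def retract_piece_map Union_Xi_fan varrho_def)
    show "\<Union>(Xi_fan N \<rho> lam g) \<inter> E \<subseteq> piece_map j ` C"
    proof
      fix y assume y: "y \<in> \<Union>(Xi_fan N \<rho> lam g) \<inter> E"
      then have "fst y \<in> \<rho>"
        by (auto simp: Union_Xi_fan piece_map_def fst_low fst_up varrho_def)
      then have "retract j y \<in> C"
        using y by (auto simp: D(2) E_def varrho_def retract_def)
      then show "y \<in> piece_map j ` C" using y by (force simp: E_def)
    qed
  qed
  ultimately show ?thesis by (auto simp: closedin_closed)
qed

text \<open>A continuous closed surjection is a quotient map. Closedness passes from the pieces to
  \<open>glue_map\<close> because they are finite in number.\<close>

lemma quotient_map_glue_map:
  "quotient_map (Sigma_pieces \<rho> g) (top_of_set (\<Union>(Xi_fan N \<rho> lam g))) glue_map"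
proof (rule continuous_closed_imp_quotient_map)
  have into: "piece_map j x \<in> \<Union>(Xi_fan N \<rho> lam g)" if "j \<in> {1..g}" "x \<in> varrho \<rho>" for j x
    using that unfolding Union_Xi_fan by blast
  show "continuous_map (Sigma_pieces \<rho> g) (top_of_set (\<Union>(Xi_fan N \<rho> lam g))) glue_map"
    unfolding continuous_map_closedin
  proof (intro conjI allI impI)
    show "glue_map \<in> topspace (Sigma_pieces \<rho> g) \<rightarrow> topspace (top_of_set (\<Union>(Xi_fan N \<rho> lam g)))"
      using into by (auto simp: topspace_Sigma_pieces glue_map_def)
    fix C assume C: "closedin (top_of_set (\<Union>(Xi_fan N \<rho> lam g))) C"
    have "closedin (top_of_set (varrho \<rho>)) (varrho \<rho> \<inter> piece_map j -` C)" if j: "j \<in> {1..g}" for j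
      using continuous_closedin_preimage_gen[OF continuous_on_subset[OF continuous_on_piece_map[OF j]] _ C]
        into[OF j] by auto
    then show "closedin (Sigma_pieces \<rho> g) {p \<in> topspace (Sigma_pieces \<rho> g). glue_map p \<in> C}"
      unfolding Sigma_pieces_def closedin_sum_topology
      by (auto simp: glue_map_def vimage_def Int_def)
  qed
  show "closed_map (Sigma_pieces \<rho> g) (top_of_set (\<Union>(Xi_fan N \<rho> lam g))) glue_map"
    unfolding closed_map_def
  proof (intro allI impI)
    fix U assume "closedin (Sigma_pieces \<rho> g) U"
    then have U: "U \<subseteq> {1..g} \<times> varrho \<rho>"
      "\<And>j. j \<in> {1..g} \<Longrightarrow> closedin (top_of_set (varrho \<rho>)) {x. (j, x) \<in> U}"
      by (auto simp: Sigma_pieces_def closedin_sum_topology)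
    have "glue_map ` U = (\<Union>j\<in>{1..g}. piece_map j ` {x. (j, x) \<in> U})"
      using U(1) by (force simp: glue_map_def)
    also have "closedin (top_of_set (\<Union>(Xi_fan N \<rho> lam g))) \<dots>"
      by (intro closedin_Union) (auto intro!: closedin_piece_map_image U(2))
    finally show "closedin (top_of_set (\<Union>(Xi_fan N \<rho> lam g))) (glue_map ` U)" .
  qed
  show "glue_map ` topspace (Sigma_pieces \<rho> g) = topspace (top_of_set (\<Union>(Xi_fan N \<rho> lam g)))"
    unfolding topspace_Sigma_pieces Union_Xi_fan by (force simp: glue_map_def)
qed

section \<open>The identifications made by the glued map\<close>

lemma low_0_eq: "low j (a, 0) = apex (j - 1) a"
  by (simp add: low_def)

text \<open>Both points go to \<open>apex (j - 1) a\<close>: the bottom of piece \<open>j\<close> by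
  the form of \<open>low\<close>, the wall of piece \<open>j - 1\<close> by
  \<open>apex_step\<close>.\<close>

lemma glue_map_glue:
  assumes "(p, q) \<in> Sigma_glue \<rho> lam g"
  shows "glue_map p = glue_map q"
proof -
  obtain j a where j: "2 \<le> j" "j \<le> g" "a \<in> \<rho>" "p = (j, a, 0)" "q = (j - 1, a, a \<bullet> \<mu> (j - 1))"
    using assms by (auto simp: Sigma_glue_def \<mu>_def numeral_2_eq_2)
  then have mem: "j \<in> {1..g}" "j - 1 \<in> {1..g}" by auto
  have "glue_map p = apex (j - 1) a"
    using j step_nonneg[OF mem(1)] by (simp add: glue_map_def piece_map_def low_0_eq)
  also have "\<dots> = glue_map q"
    using j apex_step[OF mem(2), of a] by (simp add: glue_map_def piece_map_def low_def)
  finally show ?thesis .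
qed

lemma glue_map_rtrancl:
  assumes "(p, q) \<in> (Sigma_glue \<rho> lam g \<union> (Sigma_glue \<rho> lam g)\<inverse>)\<^sup>*"
  shows "glue_map p = glue_map q"
  using assms by induction (auto dest: glue_map_glue)

lemma fst_piece_map: "fst (piece_map j x) = fst x"
  by (simp add: piece_map_def fst_low fst_up)

text \<open>
  For \<open>j < j'\<close> the j-th coordinate forces a point of the j-th piece lying in the image of the j'-th
  one onto the wall, from which it can be moved to the next piece.
\<close>

lemma piece_map_eq_imp_glued:
  assumes "j \<in> {1..g}" "j' \<in> {1..g}" "j \<le> j'" "x \<in> varrho \<rho>" "x' \<in> varrho \<rho>"
    and "piece_map j x = piece_map j' x'"
  shows "((j, x), (j', x')) \<in> (Sigma_glue \<rho> lam g \<union> (Sigma_glue \<rho> lam g)\<inverse>)\<^sup>*"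
  using assms(3,1,2,4-)
proof (induction j arbitrary: x rule: inc_induct)
  \<comment> \<open>Within a single piece the left inverse \<open>retract\<close> forces
    \<open>x = x'\<close>.\<close>
  case base
  then show ?case by (metis retract_piece_map rtrancl.rtrancl_refl)
next
  case (step j)
  obtain a v where x: "x = (a, v)" by (cases x)
  have fst: "fst x' = a" using step.prems(5) fst_piece_map x by (metis fst_conv)
  have "coord j (piece_map j' x') = a \<bullet> \<gamma> j"
    using step.hyps step.prems(1,2) fst by (auto simp: piece_map_def coord_low_less coord_up_less)
  moreover have "coord j (piece_map j x) = real (\<nu> (j - 1)) * (a \<bullet> \<gamma> (j - 1)) + v"
    using step.prems(1) x by (auto simp: piece_map_def coord_low_self coord_up_self)
  moreover have "a \<bullet> \<gamma> j = real (\<nu> (j - 1)) * (a \<bullet> \<gamma> (j - 1)) + a \<bullet> \<mu> j"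
    using step.prems(1) by (subst gamma_step) (simp_all add: inner_add_right)
  ultimately have v: "v = a \<bullet> \<mu> j" using step.prems(5) by simp
  have a: "a \<in> \<rho>" using step.prems(3) x by (auto simp: varrho_def)
  have glue: "((Suc j, a, 0), (j, x)) \<in> Sigma_glue \<rho> lam g"
    using step.hyps step.prems(1,2) a unfolding Sigma_glue_def x v \<mu>_def
    by (auto intro!: exI[of _ "Suc j"])
  have "((Suc j, a, 0), (j', x')) \<in> (Sigma_glue \<rho> lam g \<union> (Sigma_glue \<rho> lam g)\<inverse>)\<^sup>*"
  proof (rule step.IH)
    show "Suc j \<in> {1..g}" using step.hyps step.prems(2) by auto
    show "(a, 0) \<in> varrho \<rho>" using a by (auto simp: varrho_def)
    show "piece_map (Suc j) (a, 0) = piece_map j' x'"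
      using glue_map_glue[OF glue] step.prems(5) by (simp add: glue_map_def)
  qed (use step.prems in auto)
  then show ?case using glue by (meson UnI2 converse_iff converse_rtrancl_into_rtrancl)
qed

text \<open>Gluings preserve \<open>glue_map\<close>; conversely, points with equal images are
  joined by a chain of gluings, where symmetry allows ordering them by piece.\<close>

lemma Sigma_equiv_eq_kernel:
  "Sigma_equiv \<rho> lam g = {(p, q). p \<in> topspace (Sigma_pieces \<rho> g) \<and>
     q \<in> topspace (Sigma_pieces \<rho> g) \<and> glue_map p = glue_map q}"
proof -
  let ?R = "(Sigma_glue \<rho> lam g \<union> (Sigma_glue \<rho> lam g)\<inverse>)\<^sup>*"
  have sym: "sym ?R"
    by (intro sym_rtrancl sym_Un_converse)
  have "(p, q) \<in> ?R"
    if p: "p \<in> topspace (Sigma_pieces \<rho> g)" and q: "q \<in> topspace (Sigma_pieces \<rho> g)"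
      and eq: "glue_map p = glue_map q" for p q
  proof (cases "fst p \<le> fst q")
    case True
    have "((fst p, snd p), (fst q, snd q)) \<in> ?R"
      by (rule piece_map_eq_imp_glued[OF _ _ True])
        (use p q eq in \<open>simp_all add: topspace_Sigma_pieces glue_map_def mem_Times_iff\<close>)
    then show ?thesis by simp
  next
    case False
    then have "fst q \<le> fst p" by simp
    then have "((fst q, snd q), (fst p, snd p)) \<in> ?R"
      by (rule piece_map_eq_imp_glued[rotated 2])
        (use p q eq in \<open>simp_all add: topspace_Sigma_pieces glue_map_def mem_Times_iff\<close>)
    then show ?thesis using symD[OF sym] by simp
  qed
  then show ?thesis
    unfolding Sigma_equiv_def using glue_map_rtrancl by blast
qed

section \<open>The isomorphism of complexes\<close>

definition fan_map :: "(nat \<times> 'a \<times> real) set \<Rightarrow> 'a \<times> (nat \<Rightarrow>\<^sub>0 real)" where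
  "fan_map c = glue_map (SOME p. p \<in> c)"

text \<open>A class is a fibre of \<open>glue_map\<close>, so the representative chosen in
  \<open>fan_map\<close> does not matter.\<close>

lemma fan_map_class:
  assumes "p \<in> topspace (Sigma_pieces \<rho> g)"
  shows "fan_map (Sigma_equiv \<rho> lam g `` {p}) = glue_map p"
proof -
  have mem_class: "q \<in> Sigma_equiv \<rho> lam g `` {p} \<longleftrightarrow>
      q \<in> topspace (Sigma_pieces \<rho> g) \<and> glue_map p = glue_map q" for q
    unfolding Sigma_equiv_eq_kernel using assms by blast
  have "p \<in> Sigma_equiv \<rho> lam g `` {p}" using assms mem_class by blast
  then have "(SOME q. q \<in> Sigma_equiv \<rho> lam g `` {p}) \<in> Sigma_equiv \<rho> lam g `` {p}"
    by (rule someI)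
  then show ?thesis unfolding fan_map_def mem_class by metis
qed

text \<open>Applied with \<open>T\<close> equal to \<open>low j\<close> or \<open>up j\<close>. As
  \<open>T\<close> respects membership in the ambient lattices, it matches their intersections with
  the cell, hence the groups these span.\<close>

lemma cell_iso_fan_map:
  assumes T: "linear T" "inj T"
    and int: "\<And>x. x \<in> N_prime N lam (j - 1) \<longleftrightarrow> T x \<in> N_Delta N g"
    and map: "\<And>x. x \<in> \<tau> \<Longrightarrow> piece_map j x = T x"
    and j: "j \<in> {1..g}" and \<tau>: "\<tau> \<subseteq> varrho \<rho>"
  shows "cell_iso fan_map (\<tau>, zspan (\<tau> \<inter> N_prime N lam (j - 1)), \<lambda>x. Sigma_equiv \<rho> lam g `` {(j, x)})
    (T ` \<tau>, zspan (T ` \<tau> \<inter> N_Delta N g), id)"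
proof -
  have "T ` (\<tau> \<inter> N_prime N lam (j - 1)) = T ` \<tau> \<inter> N_Delta N g"
    using int by auto
  then have "lattice_cone_iso T \<tau> (zspan (\<tau> \<inter> N_prime N lam (j - 1))) (T ` \<tau>) (zspan (T ` \<tau> \<inter> N_Delta N g))"
    using T inj_on_subset[OF T(2)] by (simp add: lattice_cone_iso_def zspan_linear_image)
  moreover have "fan_map (Sigma_equiv \<rho> lam g `` {(j, x)}) = id (T x)" if "x \<in> \<tau>" for x
    using that \<tau> j map by (subst fan_map_class) (auto simp: topspace_Sigma_pieces glue_map_def)
  ultimately show ?thesis unfolding cell_iso_def by auto
qed

lemma cell_iso_minus:
  assumes j: "j \<in> {1..g}" and \<tau>: "\<tau> face_of sigma_minus \<rho> lam j"
  shows "cell_iso fan_map (\<tau>, zspan (\<tau> \<inter> N_prime N lam (j - 1)), \<lambda>x. Sigma_equiv \<rho> lam g `` {(j, x)})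
    (low j ` \<tau>, zspan (low j ` \<tau> \<inter> N_Delta N g), id)"
  by (rule cell_iso_fan_map[OF linear_low inj_low[OF j] low_integral_iff[OF j] _ j])
    (use face_of_imp_subset[OF \<tau>] piece_map_minus sigma_cover[of j] in blast)+

lemma cell_iso_plus:
  assumes j: "j \<in> {1..g}" and \<tau>: "\<tau> face_of sigma_plus \<rho> lam j"
  shows "cell_iso fan_map (\<tau>, zspan (\<tau> \<inter> N_prime N lam (j - 1)), \<lambda>x. Sigma_equiv \<rho> lam g `` {(j, x)})
    (up j ` \<tau>, zspan (up j ` \<tau> \<inter> N_Delta N g), id)"
  by (rule cell_iso_fan_map[OF linear_up inj_up[OF j] up_integral_iff[OF j] _ j])
    (use face_of_imp_subset[OF \<tau>] piece_map_plus[OF j] sigma_cover[of j] in blast)+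

text \<open>Charts correspond because the cones of the fan are exactly the images of the nonempty
  faces of the pieces under \<open>low j\<close> and \<open>up j\<close>.\<close>

theorem conic_complex_iso_fan_map:
  "conic_complex_iso fan_map (Sigma_complex N \<rho> lam g) (Xi_complex N \<rho> lam g)"
  unfolding conic_complex_iso_def
proof (intro conjI ballI)
  show "homeomorphic_map (cc_space (Sigma_complex N \<rho> lam g)) (cc_space (Xi_complex N \<rho> lam g)) fan_map"
    using homeomorphic_map_quotient_kernel[OF quotient_map_glue_map Sigma_equiv_eq_kernel fan_map_class]
    by (simp add: Sigma_complex_def Xi_complex_def)
next
  fix c assume "c \<in> cc_charts (Sigma_complex N \<rho> lam g)"
  then obtain \<tau> j where j: "j \<in> {1..g}" "\<tau> \<noteq> {}"
    and c: "c = (\<tau>, zspan (\<tau> \<inter> N_prime N lam (j - 1)), \<lambda>x. Sigma_equiv \<rho> lam g `` {(j, x)})"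
    and "\<tau> face_of sigma_minus \<rho> lam j \<or> \<tau> face_of sigma_plus \<rho> lam j"
    unfolding Sigma_complex_def by auto
  then have "\<exists>\<tau>'\<in>Xi_fan N \<rho> lam g. cell_iso fan_map c (\<tau>', zspan (\<tau>' \<inter> N_Delta N g), id)"
    unfolding Xi_fan_eq c using cell_iso_minus[OF j(1)] cell_iso_plus[OF j(1)] by blast
  then show "\<exists>c'\<in>cc_charts (Xi_complex N \<rho> lam g). cell_iso fan_map c c'"
    by (auto simp: Xi_complex_def)
next
  fix c' assume "c' \<in> cc_charts (Xi_complex N \<rho> lam g)"
  then obtain \<tau>' where c': "c' = (\<tau>', zspan (\<tau>' \<inter> N_Delta N g), id)" and "\<tau>' \<in> Xi_fan N \<rho> lam g"
    by (auto simp: Xi_complex_def)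
  then obtain \<tau> j where j: "j \<in> {1..g}" "\<tau> \<noteq> {}"
    and \<tau>: "\<tau> face_of sigma_minus \<rho> lam j \<and> \<tau>' = low j ` \<tau> \<or> \<tau> face_of sigma_plus \<rho> lam j \<and> \<tau>' = up j ` \<tau>"
    unfolding Xi_fan_eq by blast
  let ?c = "(\<tau>, zspan (\<tau> \<inter> N_prime N lam (j - 1)), \<lambda>x. Sigma_equiv \<rho> lam g `` {(j, x)})"
  have "?c \<in> cc_charts (Sigma_complex N \<rho> lam g)"
    using j \<tau> unfolding Sigma_complex_def conic_complex.simps by blast
  moreover have "cell_iso fan_map ?c c'"
    unfolding c' using \<tau> cell_iso_minus[OF j(1)] cell_iso_plus[OF j(1)] by blast
  ultimately show "\<exists>c\<in>cc_charts (Sigma_complex N \<rho> lam g). cell_iso fan_map c c'"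
    by blast
qed

end

section \<open>Passage from the polynomial to its chain of exponents\<close>

theorem proposition45:
  fixes N \<rho> :: "'a::euclidean_space set"
    and f :: "nat \<Rightarrow> 'a \<Rightarrow> complex"
    and lam :: "nat \<Rightarrow> 'a"
    and g :: nat
  assumes "full_lattice N"
    and "rational_cone N \<rho>"
    and "strictly_convex_cone \<rho>"
    and "strictly_convex_cone (dual_cone \<rho>)"
    and "quasi_ordinary N \<rho> f"
    and "\<forall>k < deg (cseries N \<rho> 1) f. coeff (UP (cseries N \<rho> 1)) f k \<in> max_ideal N \<rho>"
    and "Divisibility.irreducible (UP (cseries N \<rho> 1)) f"
    and "1 \<le> g"
    and "lam 0 = 0"
    and "lam ` {1..g} = char_exponents N \<rho> f"
    and "\<And>i j. 1 \<le> i \<Longrightarrow> i < j \<Longrightarrow> j \<le> g \<Longrightarrow> cone_le \<rho> (lam i) (lam j) \<and> lam i \<noteq> lam j"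
  shows "\<exists>h. conic_complex_iso h (Sigma_complex N \<rho> lam g) (Xi_complex N \<rho> lam g)"
proof -
  have "exponent_chain N \<rho> lam g"
  proof
    show "convex_cone \<rho>"
      using assms(2) by (auto simp: rational_cone_def convex_cone_convex_cone_hull)
    fix j assume j: "j \<in> {1..g}"
    \<comment> \<open>The first exponent lies in the dual cone by the definition of
      \<open>char_exponents\<close>, the later increments by the order of the exponents.\<close>
    show "lam j - lam (j - 1) \<in> dual_cone \<rho>"
    proof (cases "j = 1")
      case True
      then have "lam j \<in> char_exponents N \<rho> f" using assms(10) j by blast
      then show ?thesis
        using True assms(9)
        by (simp add: char_exponents_def frac_semigroup_def lattice_semigroup_def Let_def)
    next
      case False
      then show ?thesis using assms(11)[of "j - 1" j] j by (auto simp: cone_le_def)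
    qed
  qed (use assms in auto)
  then show ?thesis using exponent_chain.conic_complex_iso_fan_map by blast
qed

end
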